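(* Let $d, m \geq 1$ be integers, let $\lambda = (\lambda_1, \dots, \lambda_m)$ be a weight, and let $-\infty \leq p \leq 1/d$. Let $f_1, \dots, f_m, g_1, \dots, g_m \colon \mathbb{R}^d \to \mathbb{R}_{\geq 0}$ be integrable functions such that $0 < \| f_i \|_1 < \infty$ for every $i = 1, \dots, m$. Put $S = S(f_1) \times \dots \times S(f_m) \subset (\mathbb{R}^d)^m$ and, for $x = (x_1, \dots, x_m) \in S$, $$L(x) = M_p^\lambda \left( \frac{g_1(z_\lambda(x))}{f_1(x_1)}, \dots, \frac{g_m(z_\lambda(x))}{f_m(x_m)} \right), \qquad K = \operatorname*{ess\,inf}_{x \in S} L(x),$$ where the essential infimum is with respect to Lebesgue measure on $S$. Then $$K \leq M_{Q_d(p)}^\lambda \left( \frac{\| g_1 \|_1}{\| f_1 \|_1}, \dots, \frac{\| g_m \|_1}{\| f_m \|_1} \right).$$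
   Context: A weight is a tuple $\lambda = (\lambda_1, \dots, \lambda_m)$ of positive real numbers with $\sum_{i=1}^m \lambda_i = 1$. For a weight $\lambda$ and $-\infty \leq p \leq \infty$, the weighted power mean $M_p^\lambda \colon \mathbb{R}_{\geq 0}^m \to \mathbb{R}_{\geq 0}$ is defined by: $M_0^\lambda(a) = \prod_{i=1}^m a_i^{\lambda_i}$; $M_{-\infty}^\lambda(a) = \min_i a_i$; $M_\infty^\lambda(a) = \max_i a_i$; $M_p^\lambda(a) = 0$ if $-\infty \leq p \leq 0$ and $\prod_{i=1}^m a_i = 0$; and $M_p^\lambda(a) = \left( \sum_{i=1}^m \lambda_i a_i^p \right)^{1/p}$ otherwise. For $x = (x_1, \dots, x_m) \in (\mathbb{R}^d)^m$, $z_\lambda(x) = \sum_{i=1}^m \lambda_i x_i \in \mathbb{R}^d$. For $f \colon \mathbb{R}^d \to \mathbb{R}_{\geq 0}$, $S(f) = \{ x \in \mathbb{R}^d \mid f(x) > 0 \}$, and $\| f \|_1$ is the $L^1$ norm with respect to Lebesgue measure. The power transform $Q_d \colon [-\infty, 1/d] \to [-\infty, \infty]$ is $Q_d(p) = \frac{p}{1 - dp}$ for $-\infty < p < 1/d$, $Q_d(-\infty) = -1/d$, and $Q_d(1/d) = \infty$. *)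

theory Defs
  imports "HOL-Analysis.Analysis"
begin

definition weight :: "('m::finite \<Rightarrow> real) \<Rightarrow> bool" where
  "weight w \<longleftrightarrow> (\<forall>i. 0 < w i) \<and> (\<Sum>i\<in>UNIV. w i) = 1"

text \<open>Only used for \<open>a \<ge> 0\<close>. Note that \<open>0 powr r = 0\<close> for every real \<open>r\<close>.\<close>

definition power_mean :: "ereal \<Rightarrow> ('m::finite \<Rightarrow> real) \<Rightarrow> ('m \<Rightarrow> real) \<Rightarrow> real" where
  "power_mean p w a =
    (if p = 0 then (\<Prod>i\<in>UNIV. a i powr w i)
     else if p = -\<infinity> then Min (range a)
     else if p = \<infinity> then Max (range a)
     else if p < 0 \<and> (\<Prod>i\<in>UNIV. a i) = 0 then 0
     else (\<Sum>i\<in>UNIV. w i * a i powr real_of_ereal p) powr (1 / real_of_ereal p))"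

definition weighted_sum :: "('m::finite \<Rightarrow> real) \<Rightarrow> 'a::real_vector ^ 'm \<Rightarrow> 'a" where
  "weighted_sum w x = (\<Sum>i\<in>UNIV. w i *\<^sub>R x $ i)"

definition pos_set :: "('a \<Rightarrow> real) \<Rightarrow> 'a set" where
  "pos_set f = {x. 0 < f x}"

definition L1_norm :: "('a::euclidean_space \<Rightarrow> real) \<Rightarrow> real" where
  "L1_norm f = (LINT x|lebesgue. \<bar>f x\<bar>)"

text \<open>The value is meaningful only for \<open>p \<le> 1 / d\<close>.\<close>

definition power_transform :: "nat \<Rightarrow> ereal \<Rightarrow> ereal" where
  "power_transform d p =
    (if p = -\<infinity> then ereal (- 1 / real d)
     else if p = ereal (1 / real d) then \<infinity>
     else ereal (real_of_ereal p / (1 - real d * real_of_ereal p)))"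

definition ess_inf :: "'a measure \<Rightarrow> ('a \<Rightarrow> ereal) \<Rightarrow> ereal" where
  "ess_inf M h = Sup {c. AE x in M. c \<le> h x}"

end

theory Submission
  imports Defs "HOL-Probability.Essential_Supremum"
begin

text \<open>Since \<open>Q\<^sub>m \<circ> Q\<^sub>n = Q\<^sub>m\<^sub>+\<^sub>n\<close>, applying the inequality to sections in \<open>d - 1\<close> coordinates and then in the
  remaining one reduces the theorem to \<open>d = 1\<close> with an arbitrary exponent \<open>p \<le> 1\<close>.
  Hoelder's inequality \<open>M\<^sub>p (a b) \<le> M\<^sub>Q (a) M\<^sub>1 (b)\<close> with \<open>Q = Q\<^sub>1 (p)\<close> and \<open>a\<^sub>i\<close> the ratio of the
  integrals of \<open>g\<^sub>i\<close> and \<open>f\<^sub>i\<close> reduces that to \<open>p = 1\<close>, where some ratio has to be at least \<open>K\<close>.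
  For levels \<open>c\<^sub>i\<close> just below the essential suprema of the \<open>f\<^sub>i\<close>, the function \<open>h = (\<Sum>i. \<lambda>\<^sub>i g\<^sub>i / c\<^sub>i) / K\<close> satisfies
  \<open>h (z) \<ge> s\<close> at almost all averages \<open>z\<close> of points of the sets \<open>{f\<^sub>i \<ge> c\<^sub>i s}\<close>, \<open>s \<le> 1\<close>. By the one-dimensional
  Brunn--Minkowski inequality and integration over \<open>s\<close>, \<open>\<Sum>i. (\<lambda>\<^sub>i / c\<^sub>i) (\<integral> g\<^sub>i - K \<integral> min f\<^sub>i c\<^sub>i)\<close> is
  nonnegative, hence so is one of its terms.\<close>

section \<open>Power means\<close>

lemma power_mean_ereal:
  "power_mean (ereal r) w a =
    (if r = 0 then (\<Prod>i\<in>UNIV. a i powr w i)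
     else if r < 0 \<and> (\<exists>i. a i = 0) then 0
     else (\<Sum>i\<in>UNIV. w i * a i powr r) powr (1 / r))"
  by (auto simp: power_mean_def zero_ereal_def prod_zero_iff)

lemma power_mean_nonneg:
  fixes a :: "'m::finite \<Rightarrow> real"
  assumes "\<And>i. 0 \<le> a i"
  shows "0 \<le> power_mean p w a"
proof -
  have "0 \<le> a undefined" "a undefined \<le> Max (range a)" using assms by auto
  then have "0 \<le> Max (range a)" by linarith
  then show ?thesis
    using assms by (auto simp: power_mean_def prod_nonneg)
qed

text \<open>With \<open>M\<close> the arithmetic mean, weight the inequality
  \<open>ln u \<le> u - 1\<close> at \<open>u = b i / M\<close> and sum: the right-hand sides add up
  to zero. A zero entry makes the geometric mean vanish.\<close>

lemma weighted_arith_geo_mean: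
  fixes b w :: "'m::finite \<Rightarrow> real"
  assumes w: "weight w" and b: "\<And>i. 0 \<le> b i"
  shows "(\<Prod>i\<in>UNIV. b i powr w i) \<le> (\<Sum>i\<in>UNIV. w i * b i)"
proof (cases "\<exists>i. b i = 0")
  case True
  then have "(\<Prod>i\<in>UNIV. b i powr w i) = 0" by (auto simp: prod_zero_iff)
  also have "0 \<le> (\<Sum>i\<in>UNIV. w i * b i)"
    using w b by (intro sum_nonneg mult_nonneg_nonneg) (auto simp: weight_def less_imp_le)
  finally show ?thesis .
next
  case False
  then have pos: "0 < b i" for i using b[of i] by (metis less_eq_real_def)
  define M where "M = (\<Sum>i\<in>UNIV. w i * b i)"
  have M: "0 < M" unfolding M_def using w pos by (intro sum_pos) (auto simp: weight_def)
  have "w i * ln (b i) \<le> w i * (ln M + (b i / M - 1))" for i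
    using ln_le_minus_one[of "b i / M"] pos[of i] M w
    by (intro mult_left_mono) (auto simp: weight_def ln_div less_imp_le)
  then have "(\<Sum>i\<in>UNIV. w i * ln (b i)) \<le> (\<Sum>i\<in>UNIV. w i * (ln M + (b i / M - 1)))"
    by (intro sum_mono)
  also have "\<dots> = (\<Sum>i\<in>UNIV. w i * (ln M - 1)) + (\<Sum>i\<in>UNIV. w i * b i) / M"
    by (simp add: sum.distrib[symmetric] sum_divide_distrib algebra_simps)
  also have "\<dots> = ln M"
    using w M by (simp add: sum_distrib_right[symmetric] weight_def M_def[symmetric])
  finally have "exp (\<Sum>i\<in>UNIV. w i * ln (b i)) \<le> M"
    using M by (simp add: ln_ge_iff)
  moreover have "(\<Prod>i\<in>UNIV. b i powr w i) = exp (\<Sum>i\<in>UNIV. w i * ln (b i))"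
    using False by (simp add: exp_sum powr_def)
  ultimately show ?thesis by (simp add: M_def)
qed

text \<open>Normalise by the weighted totals \<open>U\<close> and \<open>V\<close> and apply Young's
  inequality to each term. If a total vanishes, so does every term on the left.\<close>

lemma Holder_inequality_weighted_sum:
  fixes u v w :: "'a \<Rightarrow> real"
  assumes w: "\<And>i. i \<in> I \<Longrightarrow> 0 \<le> w i"
    and u: "\<And>i. i \<in> I \<Longrightarrow> 0 \<le> u i" and v: "\<And>i. i \<in> I \<Longrightarrow> 0 \<le> v i"
    and t: "0 < t" "t < 1"
  shows "(\<Sum>i\<in>I. w i * (u i powr t * v i powr (1 - t)))
    \<le> (\<Sum>i\<in>I. w i * u i) powr t * (\<Sum>i\<in>I. w i * v i) powr (1 - t)"
proof (cases "finite I")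
  case fin: True
  define U where "U = (\<Sum>i\<in>I. w i * u i)"
  define V where "V = (\<Sum>i\<in>I. w i * v i)"
  have nonneg: "0 \<le> U" "0 \<le> V"
    unfolding U_def V_def using w u v by (auto intro!: sum_nonneg mult_nonneg_nonneg)
  show ?thesis
  proof (cases "U = 0 \<or> V = 0")
    case True
    then have "w i * (u i powr t * v i powr (1 - t)) = 0" if "i \<in> I" for i
      using fin that w u v t
      by (auto simp: U_def V_def sum_nonneg_eq_0_iff)
    then show ?thesis by (simp add: sum.neutral)
  next
    case False
    then have U: "0 < U" and V: "0 < V" using nonneg by auto
    have "u i powr t * v i powr (1 - t)
        \<le> U powr t * V powr (1 - t) * (t * (u i / U) + (1 - t) * (v i / V))" if i: "i \<in> I" for i
    proof (cases "u i = 0 \<or> v i = 0")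
      case True
      have "0 \<le> U powr t * V powr (1 - t) * (t * (u i / U) + (1 - t) * (v i / V))"
        using U V u[OF i] v[OF i] t by (intro mult_nonneg_nonneg add_nonneg_nonneg) auto
      moreover have "u i powr t * v i powr (1 - t) = 0" using True by auto
      ultimately show ?thesis by linarith
    next
      case False
      then have "0 < u i" "0 < v i" using u[OF i] v[OF i] by auto
      then have "(u i / U) powr t * (v i / V) powr (1 - t) \<le> t * (u i / U) + (1 - t) * (v i / V)"
        using U V t by (intro Youngs_inequality_0) auto
      then show ?thesis
        using U V \<open>0 < u i\<close> \<open>0 < v i\<close> by (simp add: powr_divide field_simps)
    qed
    then have "(\<Sum>i\<in>I. w i * (u i powr t * v i powr (1 - t)))
        \<le> (\<Sum>i\<in>I. w i * (U powr t * V powr (1 - t) * (t * (u i / U) + (1 - t) * (v i / V))))"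
      using w by (intro sum_mono mult_left_mono) auto
    also have "\<dots> = U powr t * V powr (1 - t) *
        (t * ((\<Sum>i\<in>I. w i * u i) / U) + (1 - t) * ((\<Sum>i\<in>I. w i * v i) / V))"
      by (simp add: sum.distrib[symmetric] sum_distrib_left sum_divide_distrib algebra_simps)
    also have "\<dots> = U powr t * V powr (1 - t)"
      using U V by (simp add: U_def[symmetric] V_def[symmetric])
    finally show ?thesis by (simp add: U_def V_def)
  qed
qed simp

text \<open>This is Hoelder's inequality with \<open>Q\<close> given by
  \<open>1/p = 1/Q + 1\<close>: for \<open>0 < p < 1\<close> in the usual form, for
  \<open>p < 0\<close> in the reversed form. The exponents -\<infinity>, 0 and 1 are limiting cases
  with direct proofs.\<close>

lemma power_mean_mult_le:
  fixes w a b :: "'m::finite \<Rightarrow> real"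
  assumes w: "weight w" and p: "p \<le> 1" and a: "\<And>i. 0 < a i" and b: "\<And>i. 0 \<le> b i"
  shows "power_mean p w (\<lambda>i. a i * b i) \<le> power_mean (power_transform 1 p) w a * (\<Sum>i\<in>UNIV. w i * b i)"
proof -
  have w0: "0 < w i" "0 \<le> w i" for i using w by (auto simp: weight_def less_imp_le)
  define B where "B = (\<Sum>i\<in>UNIV. w i * b i)"
  have B: "0 \<le> B" unfolding B_def using w0 b by (auto intro!: sum_nonneg)
  have a0: "0 \<le> a i" "a i \<noteq> 0" for i using a[of i] by auto
  show ?thesis
  proof (cases p)
    case PInf
    then show ?thesis using p by simp
  next
    case MInf
    define M where "M = Min (range (\<lambda>i. a i * b i))"
    define C where "C = (\<Sum>i\<in>UNIV. w i * a i powr (- 1))"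
    have "M \<le> a i * b i" for i unfolding M_def by (intro Min_le) auto
    \<comment> \<open>Since \<open>Q_1(-\<infinity>) = -1\<close>, the mean of \<open>a\<close> in
      the claim is the harmonic one, \<open>1 / C\<close>. Hence \<open>M \<le> a i * b i\<close> is
      divided by \<open>a i\<close> before summing.\<close>
    then have "w i * (M * a i powr (- 1)) \<le> w i * b i" for i
      using a[of i] w0[of i] by (intro mult_left_mono) (auto simp: powr_minus field_simps)
    then have "(\<Sum>i\<in>UNIV. w i * (M * a i powr (- 1))) \<le> B" unfolding B_def by (intro sum_mono)
    then have "M * C \<le> B" by (simp add: C_def sum_distrib_left algebra_simps)
    moreover have C: "0 < C" unfolding C_def using w0 a by (intro sum_pos) (auto simp: less_imp_neq[symmetric])
    ultimately have "M \<le> C powr (- 1) * B"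
      by (simp add: powr_minus field_simps)
    then show ?thesis
      using MInf a0 by (simp add: power_transform_def power_mean_ereal M_def C_def B_def)
         (simp add: power_mean_def)
  next
    case (real r)
    then have r: "r \<le> 1" using p by simp
    consider "r = 1" | "r = 0" | "0 < r" "r < 1" | "r < 0" using r by linarith
    then show ?thesis
    proof cases
      case 1
      have "(\<Sum>i\<in>UNIV. w i * (a i * b i)) \<le> (\<Sum>i\<in>UNIV. Max (range a) * (w i * b i))"
      proof (intro sum_mono)
        fix i
        have "a i * (w i * b i) \<le> Max (range a) * (w i * b i)"
          using w0 b by (intro mult_right_mono Max_ge) auto
        then show "w i * (a i * b i) \<le> Max (range a) * (w i * b i)" by (simp add: algebra_simps)
      qed
      also have "\<dots> = Max (range a) * B" by (simp add: B_def sum_distrib_left)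
      finally show ?thesis
        using real 1 w0 a0 b
        by (simp add: power_transform_def power_mean_ereal B_def sum_nonneg)
          (simp add: power_mean_def)
    next
      case 2
      have "(\<Prod>i\<in>UNIV. (a i * b i) powr w i) = (\<Prod>i\<in>UNIV. a i powr w i) * (\<Prod>i\<in>UNIV. b i powr w i)"
        using a0 b by (simp add: powr_mult prod.distrib)
      also have "\<dots> \<le> (\<Prod>i\<in>UNIV. a i powr w i) * B"
        unfolding B_def using weighted_arith_geo_mean[OF w b] by (intro mult_left_mono prod_nonneg) auto
      finally show ?thesis using real 2 by (simp add: power_transform_def power_mean_ereal B_def)
    next
      case 3
      define C where "C = (\<Sum>i\<in>UNIV. w i * a i powr (r / (1 - r)))"
      have C: "0 \<le> C" unfolding C_def using w0 by (auto intro!: sum_nonneg)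
      have "(\<Sum>i\<in>UNIV. w i * (a i * b i) powr r)
          = (\<Sum>i\<in>UNIV. w i * (b i powr r * (a i powr (r / (1 - r))) powr (1 - r)))"
        using 3 a0 b by (intro sum.cong) (auto simp: powr_mult powr_powr)
      also have "\<dots> \<le> B powr r * C powr (1 - r)"
        unfolding B_def C_def using w0 b 3 by (intro Holder_inequality_weighted_sum) auto
      finally have "(\<Sum>i\<in>UNIV. w i * (a i * b i) powr r) powr (1 / r) \<le> (B powr r * C powr (1 - r)) powr (1 / r)"
        using 3 w0 by (intro powr_mono2) (auto intro!: sum_nonneg)
      also have "\<dots> = C powr ((1 - r) / r) * B"
        using 3 B C by (simp add: powr_mult powr_powr)
      finally show ?thesis
        using real 3 a0 by (simp add: power_transform_def power_mean_ereal B_def C_def)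
    next
      case 4
      show ?thesis
      proof (cases "\<exists>i. b i = 0")
        case True
        then have "power_mean p w (\<lambda>i. a i * b i) = 0"
          using 4 real by (auto simp: power_mean_ereal)
        then show ?thesis
          using power_mean_nonneg[OF a0(1), of _ w] B by (simp add: B_def)
      next
        case False
        then have b': "0 < b i" for i using b[of i] by (metis less_eq_real_def)
        \<comment> \<open>For this \<open>t\<close>, the product \<open>r * t\<close> is
          \<open>Q_1(r)\<close>, and \<open>r * t + (1 - t) = 0\<close>. The powers of
          \<open>b i\<close> therefore cancel, and \<open>a i powr (r * t)\<close> becomes a Hoelder
          product of \<open>(a i * b i) powr r\<close> and \<open>b i\<close>.\<close>
        define t where "t = 1 / (1 - r)"
        have t: "0 < t" "t < 1" "r * t = t - 1" "1 / r = - t / (1 - t)"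
          using 4 by (auto simp: t_def field_simps)
        define C where "C = (\<Sum>i\<in>UNIV. w i * a i powr (r * t))"
        define D where "D = (\<Sum>i\<in>UNIV. w i * (a i * b i) powr r)"
        have pos: "0 < B" "0 < C" "0 < D"
          unfolding B_def C_def D_def using w0 a b' a0
          by (auto intro!: sum_pos simp: less_imp_neq[symmetric])
        have "C = (\<Sum>i\<in>UNIV. w i * (((a i * b i) powr r) powr t * b i powr (1 - t)))"
        proof -
          have "((a i * b i) powr r) powr t * b i powr (1 - t) = a i powr (r * t)" for i
          proof -
            have "((a i * b i) powr r) powr t * b i powr (1 - t)
                = a i powr (r * t) * (b i powr (r * t) * b i powr (1 - t))"
              using a0 b by (simp add: powr_mult powr_powr)
            also have "b i powr (r * t) * b i powr (1 - t) = 1"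
              using b'[of i] by (simp add: powr_add[symmetric] t(3))
            finally show ?thesis by simp
          qed
          then show ?thesis by (simp add: C_def)
        qed
        also have "\<dots> \<le> D powr t * B powr (1 - t)"
          unfolding B_def D_def using w0 b t by (intro Holder_inequality_weighted_sum) auto
        \<comment> \<open>A negative exponent reverses the inequality. This one turns
          \<open>B powr (1 - t)\<close> into \<open>1 / B\<close> and equals
          \<open>1 / (r * t)\<close>, the outer exponent in the mean of \<open>a\<close>.\<close>
        finally have "(D powr t * B powr (1 - t)) powr (- 1 / (1 - t)) \<le> C powr (- 1 / (1 - t))"
          using pos t by (intro powr_mono2') (auto simp: divide_nonpos_pos)
        also have "(D powr t * B powr (1 - t)) powr (- 1 / (1 - t)) = D powr (1 / r) * B powr - 1"
          using pos t by (simp add: powr_mult powr_powr)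
        finally have "D powr (1 / r) * B powr - 1 * B \<le> C powr (- 1 / (1 - t)) * B"
          using pos by (intro mult_right_mono) auto
        then have "D powr (1 / r) \<le> C powr (- 1 / (1 - t)) * B"
          using pos by (simp add: powr_minus mult.assoc)
        moreover have "- 1 / (1 - t) = 1 / (r * t)"
        proof -
          have "1 - t = - (r * t)" using t(3) by simp
          then show ?thesis by simp
        qed
        moreover have "power_transform 1 p = ereal (r * t)"
          using real 4 by (simp add: power_transform_def t_def)
        ultimately show ?thesis
          using real 4 t a0 False
          by (simp add: power_mean_ereal C_def D_def B_def)
      qed
    qed
  qed
qed

text \<open>Ratios of integrals may be zero, whereas \<open>power_mean_mult_le\<close> asks for
  positive \<open>a\<close>. Adding \<open>e\<close> and letting it tend to 0 bridges the gap,
  because the mean is continuous from the right along this perturbation.\<close>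

lemma power_mean_le_of_perturbation:
  fixes w a :: "'m::finite \<Rightarrow> real"
  assumes w: "weight w" and a: "\<And>i. 0 \<le> a i" and q: "q \<noteq> -\<infinity>"
    and le: "\<And>e. 0 < e \<Longrightarrow> K \<le> power_mean q w (\<lambda>i. a i + e)"
  shows "K \<le> power_mean q w a"
proof -
  have w0: "0 < w i" "0 \<le> w i" for i using w by (auto simp: weight_def less_imp_le)
  have ev: "\<forall>\<^sub>F e in at_right 0. (0::real) < e" by (simp add: eventually_at_right_less)
  have lim: "((\<lambda>e. a i + e) \<longlongrightarrow> a i) (at_right 0)" for i
    by (auto intro!: tendsto_eq_intros)
  have evnn: "\<forall>\<^sub>F e in at_right 0. 0 \<le> a i + e" for i
    by (rule eventually_mono[OF ev]) (use a[of i] in auto)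
  have I: "K \<le> power_mean q w a" if "((\<lambda>e. power_mean q w (\<lambda>i. a i + e)) \<longlongrightarrow> power_mean q w a) (at_right 0)"
    using that eventually_mono[OF ev le] by (rule tendsto_lowerbound) auto
  show ?thesis
  proof (cases q)
    case MInf then show ?thesis using q by simp
  next
    case PInf
    have "Max (range (\<lambda>i. a i + e)) = Max (range a) + e" for e
    proof (rule Max_eqI)
      have "Max (range a) \<in> range a" by (rule Max_in) auto
      then obtain i where "Max (range a) = a i" by (rule imageE)
      then show "Max (range a) + e \<in> range (\<lambda>i. a i + e)" by simp
    qed (auto intro!: Max_ge)
    then have "K \<le> Max (range a) + e" if "0 < e" for e
      using le[OF that] PInf by (simp add: power_mean_def)
    then show ?thesis using PInf by (simp add: power_mean_def field_le_epsilon)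
  next
    case (real r)
    consider "r = 0" | "0 < r" | "r < 0" "\<And>i. 0 < a i" | i where "r < 0" "a i = 0"
      using a by (metis less_eq_real_def linorder_neqE_linordered_idom)
    then show ?thesis
    proof cases
      case 1
      show ?thesis
        using real 1 w0 by (intro I) (auto simp: power_mean_ereal intro!: tendsto_prod tendsto_powr2 lim evnn)
    next
      case 2
      have "((\<lambda>e. (\<Sum>i\<in>UNIV. w i * (a i + e) powr r) powr (1 / r)) \<longlongrightarrow>
         (\<Sum>i\<in>UNIV. w i * a i powr r) powr (1 / r)) (at_right 0)"
      proof (rule tendsto_powr2)
        show "\<forall>\<^sub>F x in at_right 0. 0 \<le> (\<Sum>i\<in>UNIV. w i * (a i + x) powr r)"
          using w0 by (intro always_eventually allI sum_nonneg) auto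
      qed (use 2 in \<open>auto intro!: tendsto_sum tendsto_mult tendsto_powr2 lim evnn\<close>)
      then show ?thesis
        using real 2 by (intro I) (auto simp: power_mean_ereal)
    next
      case 3
      have nz: "a i \<noteq> 0" for i using 3(2)[of i] by simp
      have "0 < (\<Sum>i\<in>UNIV. w i * a i powr r)" using w0 nz by (intro sum_pos) auto
      then have "((\<lambda>e. (\<Sum>i\<in>UNIV. w i * (a i + e) powr r) powr (1 / r)) \<longlongrightarrow>
         (\<Sum>i\<in>UNIV. w i * a i powr r) powr (1 / r)) (at_right 0)"
        using nz by (intro tendsto_powr tendsto_sum tendsto_mult lim tendsto_const) auto
      moreover have "\<forall>\<^sub>F e in at_right 0. (\<Sum>i\<in>UNIV. w i * (a i + e) powr r) powr (1 / r)
          = power_mean q w (\<lambda>i. a i + e)"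
        by (rule eventually_mono[OF ev])
           (use 3 real in \<open>auto simp: power_mean_ereal add_pos_pos less_imp_neq[symmetric] dest!: add_pos_pos\<close>)
      ultimately show ?thesis
        using real 3 nz by (intro I) (auto simp: power_mean_ereal elim: Lim_transform_eventually)
    next
      case 4
      \<comment> \<open>The limit cannot be taken inside the sum: \<open>e powr r\<close> blows up
        while \<open>0 powr r = 0\<close>. The single term at \<open>i\<close> already bounds the
        perturbed mean by a multiple of \<open>e\<close>, which matches the value 0 that the
        definition assigns.\<close>
      have "K \<le> w i powr (1 / r) * e" if e: "0 < e" for e
      proof -
        have nz: "a k + e \<noteq> 0" for k using a[of k] e by auto
        have "w i * e powr r = w i * (a i + e) powr r" using 4 by simp
        also have "\<dots> \<le> (\<Sum>i\<in>UNIV. w i * (a i + e) powr r)"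
          using w0 by (intro member_le_sum) auto
        finally have "(\<Sum>i\<in>UNIV. w i * (a i + e) powr r) powr (1 / r) \<le> (w i * e powr r) powr (1 / r)"
          using 4 w0[of i] e by (intro powr_mono2') auto
        also have "\<dots> = w i powr (1 / r) * e"
          using 4 w0[of i] e by (simp add: powr_mult powr_powr)
        finally show ?thesis using le[OF e] nz real 4 by (auto simp: power_mean_ereal)
      qed
      then have "\<forall>\<^sub>F e in at_right 0. K \<le> w i powr (1 / r) * e"
        using ev by (auto elim: eventually_mono)
      moreover have "((\<lambda>e. w i powr (1 / r) * e) \<longlongrightarrow> 0) (at_right 0)"
        by (auto intro!: tendsto_eq_intros)
      ultimately have "K \<le> 0" by (intro tendsto_lowerbound) auto
      also have "0 \<le> power_mean q w a" by (rule power_mean_nonneg[OF a])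
      finally show ?thesis .
    qed
  qed
qed

section \<open>Range and composition of the power transforms\<close>

lemma power_transform_neq_MInf [simp]: "power_transform d p \<noteq> -\<infinity>"
  by (simp add: power_transform_def)

text \<open>This keeps the exponent admissible for the one-dimensional inequality after
  \<open>n\<close> coordinates have been integrated out. For real \<open>p < 1 / n\<close>, the
  bound \<open>Q_n(p) \<le> 1\<close> says \<open>p \<le> 1 - n p\<close>.\<close>

lemma power_transform_le_one:
  assumes "0 < n" "p \<le> ereal (1 / real (Suc n))"
  shows "power_transform n p \<le> 1"
proof (cases p)
  case (real r)
  have r: "r \<le> 1 / (real n + 1)" using assms real by (simp add: add.commute)
  then have "r * (real n + 1) \<le> 1" by (simp add: field_simps)
  moreover have "1 / (real n + 1) < 1 / real n" using assms by (simp add: field_simps)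
  with r have "r < 1 / real n" by linarith
  then have "real n * r < 1" using assms by (simp add: field_simps)
  ultimately show ?thesis
    using real \<open>r < 1 / real n\<close> by (simp add: power_transform_def field_simps)
next
  case MInf
  have "- 1 \<le> 1 / real n" by (rule order_trans[of _ 0]) auto
  then show ?thesis using MInf by (simp add: power_transform_def)
qed (use assms in simp)

text \<open>On reciprocals \<open>Q_1\<close> subtracts 1, with -\<infinity> and \<infinity> having
  reciprocal 0, so iterating it \<open>n + 1\<close> times subtracts \<open>n + 1\<close>. The
  exponent 0 is fixed.\<close>

lemma power_transform_funpow:
  assumes "p \<le> ereal (1 / real (Suc n))"
  shows "(power_transform 1 ^^ Suc n) p = power_transform (Suc n) p"
  using assms
proof (induction n)
  case 0
  then show ?case by simp
next
  case (Suc n)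
  have le: "1 / real (Suc (Suc n)) < 1 / real (Suc n)" by (simp add: field_simps)
  then have "p \<le> ereal (1 / real (Suc n))"
    using Suc.prems by (meson ereal_less_eq(3) less_imp_le order_trans)
  then have IH: "(power_transform 1 ^^ Suc n) p = power_transform (Suc n) p" by (rule Suc.IH)
  have "power_transform 1 (power_transform (Suc n) p) = power_transform (Suc (Suc n)) p"
  proof (cases p)
    case (real r)
    define N where "N = real (Suc n)"
    have N: "0 < N" "real (Suc (Suc n)) = N + 1" by (auto simp: N_def)
    have r: "r \<le> 1 / (N + 1)" using Suc.prems real unfolding N(2) by simp
    then have "r < 1 / N" using le N(2) by (simp add: N_def)
    then have d: "0 < 1 - N * r" using N by (simp add: field_simps)
    \<comment> \<open>The outer \<open>Q_1\<close> takes its exceptional value \<infinity> only at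
      1, and this matches the endpoint at which \<open>Q_{N+1}\<close> is \<infinity>.\<close>
    have "r / (1 - N * r) = 1 \<longleftrightarrow> r = 1 / (N + 1)"
      using d N by (simp add: field_simps)
    moreover have "r / (1 - N * r) / (1 - r / (1 - N * r)) = r / (1 - (N + 1) * r)"
      using d by (simp add: divide_simps) (simp add: algebra_simps)
    ultimately show ?thesis
      using \<open>r < 1 / N\<close> real unfolding power_transform_def N(2) N_def[symmetric] by simp
  next
    case MInf
    have "- 1 / real (Suc n) / (1 - - 1 / real (Suc n)) = - 1 / real (Suc (Suc n))"
      by (simp add: field_simps)
    moreover have "- 1 / real (Suc n) < 1" by (simp add: field_simps)
    ultimately show ?thesis using MInf by (simp add: power_transform_def)
  qed (use Suc.prems in simp)
  then show ?case using IH by simp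
qed

section \<open>Null sets and product measures\<close>

text \<open>With \<open>r\<close> a right inverse of \<open>h\<close>, translation by
  \<open>r v\<close> replaces \<open>h x\<close> by \<open>v + h x\<close> without changing the
  integral over \<open>x\<close>. Integrating also over \<open>v\<close> and exchanging the order
  gives measure of the preimage times infinity on one side, and an integral of the measure of
  \<open>N\<close>, hence 0, on the other.\<close>

lemma null_sets_vimage_linear_surj:
  fixes h :: "'a::euclidean_space \<Rightarrow> 'b::euclidean_space"
  assumes h: "linear h" "surj h" and N: "N \<in> null_sets lborel"
  shows "h -` N \<in> null_sets lborel"
proof -
  have N'[measurable]: "N \<in> sets borel" using N by auto
  have hm[measurable]: "h \<in> borel_measurable borel"
    using h by (intro borel_measurable_continuous_onI linear_continuous_on) (simp add: linear_conv_bounded_linear)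
  obtain r where r: "linear r" "h \<circ> r = id"
    using linear_surjective_right_inverse[OF h] by blast
  have rm[measurable]: "r \<in> borel_measurable borel"
    using r by (intro borel_measurable_continuous_onI linear_continuous_on) (simp add: linear_conv_bounded_linear)
  have hr: "h (r v + x) = v + h x" for v x
    using h(1) r(2) by (simp add: linear_add fun_eq_iff)
  have trans: "(\<integral>\<^sup>+x. F (c + x) \<partial>lborel) = (\<integral>\<^sup>+x. F x \<partial>lborel)"
    if [measurable]: "F \<in> borel_measurable borel" for F :: "'c::euclidean_space \<Rightarrow> ennreal" and c
    using nn_integral_distr[of "(+) c" lborel borel F] by (simp add: lborel_distr_plus)
  have "emeasure lborel (h -` N) * emeasure lborel (UNIV :: 'b set)
      = (\<integral>\<^sup>+v. (\<integral>\<^sup>+x. indicator N (h x) \<partial>lborel) \<partial>(lborel :: 'b measure))"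
  proof -
    have "(\<integral>\<^sup>+x. indicator N (h x) \<partial>lborel) = (\<integral>\<^sup>+x. indicator (h -` N) x \<partial>lborel)"
      by (intro nn_integral_cong) (auto simp: indicator_def)
    also have "\<dots> = emeasure lborel (h -` N)"
      using measurable_sets[OF hm N'] by (simp add: nn_integral_indicator)
    finally show ?thesis by simp
  qed
  also have "\<dots> = (\<integral>\<^sup>+v. (\<integral>\<^sup>+x. indicator N (v + h x) \<partial>lborel) \<partial>lborel)"
    using trans[of "\<lambda>x. indicator N (h x)" "r _"] by (simp add: hr)
  also have "\<dots> = (\<integral>\<^sup>+x. (\<integral>\<^sup>+v. indicator N (v + h x) \<partial>lborel) \<partial>lborel)"
    by (rule lborel_pair.Fubini') simp
  also have "\<dots> = (\<integral>\<^sup>+x. (\<integral>\<^sup>+v. indicator N v \<partial>lborel) \<partial>(lborel :: 'a measure))"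
    using trans[of "indicator N" "h _"] by (simp add: add.commute)
  also have "\<dots> = 0" using N by auto
  finally have "emeasure lborel (h -` N) = 0" by simp
  then show ?thesis using measurable_sets[OF hm N'] by (auto simp: null_sets_def)
qed

lemma AE_lborel_linear_surj:
  fixes h :: "'a::euclidean_space \<Rightarrow> 'b::euclidean_space"
  assumes h: "linear h" "surj h" and P: "AE y in lborel. P y"
  shows "AE x in lborel. P (h x)"
proof -
  obtain N where N: "N \<in> null_sets lborel" "{y \<in> space lborel. \<not> P y} \<subseteq> N"
    using P by (auto simp: eventually_ae_filter)
  show ?thesis
    by (rule AE_I'[OF null_sets_vimage_linear_surj[OF h N(1)]]) (use N(2) in auto)
qed

interpretation lborel_power: product_sigma_finite "\<lambda>_. lborel"
  by standard

lemma PiM_insert_eq_distr: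
  assumes J: "finite J" "j \<notin> J" and M: "product_sigma_finite M"
  shows "PiM (insert j J) M = distr (M j \<Otimes>\<^sub>M PiM J M) (PiM (insert j J) M) (\<lambda>(y, X). X(j := y))"
proof -
  interpret product_sigma_finite M by fact
  interpret S: sigma_finite_measure "PiM J M" by (rule sigma_finite[OF J(1)])
  have m: "(\<lambda>(y, X). X(j := y)) \<in> M j \<Otimes>\<^sub>M PiM J M \<rightarrow>\<^sub>M PiM (insert j J) M"
    by measurable
  show ?thesis
  proof (rule PiM_eqI[symmetric])
    fix A assume A: "\<And>i. i \<in> insert j J \<Longrightarrow> A i \<in> sets (M i)"
    have "(\<lambda>(y, X). X(j := y)) -` Pi\<^sub>E (insert j J) A \<inter> space (M j \<Otimes>\<^sub>M PiM J M) = A j \<times> Pi\<^sub>E J A"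
      using A[THEN sets.sets_into_space] J
      by (auto simp: space_pair_measure space_PiM PiE_iff extensional_def split: if_splits)
    then show "emeasure (distr (M j \<Otimes>\<^sub>M PiM J M) (PiM (insert j J) M) (\<lambda>(y, X). X(j := y))) (Pi\<^sub>E (insert j J) A)
      = (\<Prod>i\<in>insert j J. emeasure (M i) (A i))"
      using A J m
      by (subst emeasure_distr) (auto simp: S.emeasure_pair_measure_Times emeasure_PiM)
  qed (use J in auto)
qed

text \<open>Fubini in both orders: the new coordinate is outermost in the induction on the
  dimension, and innermost when the last summand is split off in the Brunn-Minkowski inequality for
  sums.\<close>

lemma AE_PiM_insert:
  assumes J: "finite J" "j \<notin> J" and M: "product_sigma_finite M"
    and P: "AE X in PiM (insert j J) M. P X"
  shows "AE y in M j. AE X in PiM J M. P (X(j := y))"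
    and "AE X in PiM J M. AE y in M j. P (X(j := y))"
proof -
  interpret product_sigma_finite M by fact
  interpret S: sigma_finite_measure "PiM J M" by (rule sigma_finite[OF J(1)])
  interpret P1: pair_sigma_finite "M j" "PiM J M" ..
  interpret P2: pair_sigma_finite "PiM J M" "M j" ..
  have m: "(\<lambda>(y, X). X(j := y)) \<in> M j \<Otimes>\<^sub>M PiM J M \<rightarrow>\<^sub>M PiM (insert j J) M"
    by measurable
  have *: "AE z in M j \<Otimes>\<^sub>M PiM J M. P ((\<lambda>(y, X). X(j := y)) z)"
    using P by (subst (asm) PiM_insert_eq_distr[OF J M]) (rule AE_distrD[OF m])
  from P1.AE_pair[OF this] show "AE y in M j. AE X in PiM J M. P (X(j := y))" by simp
  from * have "AE z in PiM J M \<Otimes>\<^sub>M M j. P ((\<lambda>(y, X). X(j := y)) ((\<lambda>(x, y). (y, x)) z))"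
    by (subst (asm) P1.distr_pair_swap) (rule AE_distrD[OF measurable_pair_swap'])
  from P2.AE_pair[OF this] show "AE X in PiM J M. AE y in M j. P (X(j := y))" by simp
qed

section \<open>An essential one-dimensional Brunn--Minkowski inequality\<close>

lemma AE_imp_ex:
  assumes "AE x in M. P x" and "0 < emeasure M A" and "A \<in> sets M"
  obtains x where "x \<in> A" "P x"
proof -
  have "\<not> (AE x in M. x \<notin> A)"
  proof
    assume "AE x in M. x \<notin> A"
    moreover have "{x \<in> space M. \<not> x \<notin> A} = A" using sets.sets_into_space[OF assms(3)] by auto
    ultimately show False using assms(2,3) AE_iff_measurable[of A M "\<lambda>x. x \<notin> A"] by auto
  qed
  then show ?thesis using assms(1) that by (metis (mono_tags, lifting) AE_mp AE_I2)
qed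

text \<open>The bound is the essential supremum of the identity on \<open>A\<close>, extended by
  -\<infinity> outside \<open>A\<close>. Boundedness and positive measure of \<open>A\<close> make
  it a real number.\<close>

lemma ex_essential_upper_bound:
  fixes A :: "real set"
  assumes A[measurable]: "A \<in> sets borel" and bd: "bounded A" and pos: "0 < emeasure lborel A"
  obtains \<alpha> where "AE x in lborel. x \<in> A \<longrightarrow> x \<le> \<alpha>"
    and "\<And>t. t < \<alpha> \<Longrightarrow> 0 < emeasure lborel (A \<inter> {t<..})"
proof -
  define f where "f x = (if x \<in> A then ereal x else - \<infinity>)" for x
  have [measurable]: "f \<in> borel_measurable lborel" unfolding f_def by measurable
  define e where "e = esssup lborel f"
  have AE: "AE x in lborel. f x \<le> e" unfolding e_def by (rule esssup_AE)
  obtain x where x: "x \<in> A" "f x \<le> e" using AE_imp_ex[OF AE pos] by auto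
  obtain b where b: "\<And>x. x \<in> A \<Longrightarrow> \<bar>x\<bar> \<le> b" using bd by (auto simp: bounded_iff)
  have "f x \<le> ereal b" for x using b[of x] by (auto simp: f_def)
  then have "e \<le> ereal b" unfolding e_def by (intro esssup_I) auto
  moreover have "ereal x \<le> e" using x by (simp add: f_def)
  ultimately obtain \<alpha> where \<alpha>: "e = ereal \<alpha>" by (cases e) auto
  show ?thesis
  proof
    show "AE x in lborel. x \<in> A \<longrightarrow> x \<le> \<alpha>" using AE by eventually_elim (auto simp: f_def \<alpha>)
    fix t assume "t < \<alpha>"
    then have "0 < emeasure lborel {x \<in> space lborel. f x > ereal t}"
      by (intro esssup_pos_measure) (simp_all add: e_def[symmetric] \<alpha>)
    also have "{x \<in> space lborel. f x > ereal t} = A \<inter> {t<..}" by (auto simp: f_def)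
    finally show "0 < emeasure lborel (A \<inter> {t<..})" .
  qed
qed

lemma emeasure_lborel_uminus:
  fixes A :: "real set"
  assumes [measurable]: "A \<in> sets borel"
  shows "emeasure lborel (uminus -` A) = emeasure lborel A"
  using emeasure_distr[of uminus lborel borel A] by (simp add: lborel_distr_uminus)

lemma AE_lborel_uminus:
  fixes P :: "real \<Rightarrow> bool"
  assumes "AE x in lborel. P x"
  shows "AE x in lborel. P (- x)"
  by (rule AE_lborel_linear_surj[OF _ _ assms])
     (auto simp: linear_iff intro!: surjI[of _ uminus])

lemma ex_essential_lower_bound:
  fixes A :: "real set"
  assumes A[measurable]: "A \<in> sets borel" and bd: "bounded A" and pos: "0 < emeasure lborel A"
  obtains \<alpha> where "AE x in lborel. x \<in> A \<longrightarrow> \<alpha> \<le> x"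
    and "\<And>t. \<alpha> < t \<Longrightarrow> 0 < emeasure lborel (A \<inter> {..<t})"
proof -
  have bor: "uminus -` A \<in> sets borel"
    using measurable_sets[of uminus borel borel A] by simp
  obtain b where b: "\<And>x. x \<in> A \<Longrightarrow> \<bar>x\<bar> \<le> b" using bd by (auto simp: bounded_iff)
  have bd': "bounded (uminus -` A)"
    by (rule boundedI[of _ b]) (use b[of "- _"] in auto)
  have pos': "0 < emeasure lborel (uminus -` A)" using pos by (simp add: emeasure_lborel_uminus)
  obtain a where
    a: "AE x in lborel. x \<in> uminus -` A \<longrightarrow> x \<le> a"
      "\<And>t. t < a \<Longrightarrow> 0 < emeasure lborel (uminus -` A \<inter> {t<..})"
    by (rule ex_essential_upper_bound[OF bor bd' pos']) auto
  show ?thesis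
  proof
    show "AE x in lborel. x \<in> A \<longrightarrow> - a \<le> x"
      using AE_lborel_uminus[OF a(1)] by eventually_elim auto
    fix t assume "- a < t"
    then have "0 < emeasure lborel (uminus -` A \<inter> {-t<..})" by (intro a(2)) auto
    also have "uminus -` A \<inter> {-t<..} = uminus -` (A \<inter> {..<t})" by auto
    also have "emeasure lborel \<dots> = emeasure lborel (A \<inter> {..<t})"
      by (rule emeasure_lborel_uminus) measurable
    finally show "0 < emeasure lborel (A \<inter> {..<t})" .
  qed
qed

lemma emeasure_le_of_AE_translate:
  fixes A B :: "real set"
  assumes [measurable]: "A \<in> sets borel" "B \<in> sets borel"
    and "AE t in lborel. t \<in> A \<longrightarrow> c + t \<in> B"
  shows "emeasure lborel A \<le> emeasure lborel B"
proof -
  have m: "(+) c -` B \<in> sets borel" using measurable_sets[of "(+) c" borel borel B] by simp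
  have "emeasure lborel A \<le> emeasure lborel ((+) c -` B)"
    using assms(3) m by (intro emeasure_mono_AE) (auto elim: eventually_mono)
  also have "\<dots> = emeasure lborel B"
    using emeasure_distr[of "(+) c" lborel borel B] by (simp add: lborel_distr_plus)
  finally show ?thesis .
qed

text \<open>If \<open>x\<close> is close to the essential supremum of \<open>A\<close> and \<open>y\<close> to the essential infimum of \<open>C\<close>,
  then the translates \<open>y + A\<close> and \<open>x + C\<close>, essentially contained in \<open>B\<close>, overlap in a short interval.\<close>

lemma essential_Brunn_Minkowski_bounded:
  fixes A B C :: "real set"
  assumes [measurable]: "A \<in> sets borel" "B \<in> sets borel" "C \<in> sets borel"
    and bd: "bounded A" "bounded C"
    and pos: "0 < emeasure lborel A" "0 < emeasure lborel C"
    and AE1: "AE x in lborel. AE y in lborel. x \<in> A \<and> y \<in> C \<longrightarrow> x + y \<in> B"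
    and AE2: "AE y in lborel. AE x in lborel. x \<in> A \<and> y \<in> C \<longrightarrow> x + y \<in> B"
  shows "emeasure lborel A + emeasure lborel C \<le> emeasure lborel B"
proof (rule ennreal_le_epsilon)
  fix e :: real assume e: "0 < e"
  obtain \<alpha> where \<alpha>: "AE x in lborel. x \<in> A \<longrightarrow> x \<le> \<alpha>"
    "\<And>t. t < \<alpha> \<Longrightarrow> 0 < emeasure lborel (A \<inter> {t<..})"
    by (rule ex_essential_upper_bound[OF _ bd(1) pos(1)]) auto
  obtain \<gamma> where \<gamma>: "AE x in lborel. x \<in> C \<longrightarrow> \<gamma> \<le> x"
    "\<And>t. \<gamma> < t \<Longrightarrow> 0 < emeasure lborel (C \<inter> {..<t})"
    by (rule ex_essential_lower_bound[OF _ bd(2) pos(2)]) auto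
  obtain x where x: "x \<in> A" "\<alpha> - e / 2 < x" and xB: "AE y in lborel. x \<in> A \<and> y \<in> C \<longrightarrow> x + y \<in> B"
    using AE_imp_ex[OF AE1 \<alpha>(2)[of "\<alpha> - e / 2"]] e by auto
  obtain y where y: "y \<in> C" "y < \<gamma> + e / 2" and yB: "AE x in lborel. x \<in> A \<and> y \<in> C \<longrightarrow> x + y \<in> B"
    using AE_imp_ex[OF AE2 \<gamma>(2)[of "\<gamma> + e / 2"]] e by auto
  \<comment> \<open>The cut is placed so that \<open>y + A\<close> lies essentially below
    \<open>s\<close>, because \<open>y < \<gamma> + e / 2\<close>. As
    \<open>x > \<alpha> - e / 2\<close>, points of \<open>C\<close> beyond
    \<open>\<gamma> + e\<close> are moved by \<open>x\<close> above \<open>s\<close>, so only an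
    interval of length \<open>e\<close> is lost.\<close>
  define s where "s = \<alpha> + \<gamma> + e / 2"
  have "emeasure lborel A \<le> emeasure lborel (B \<inter> {..s})"
    by (rule emeasure_le_of_AE_translate[where c=y])
       (use \<alpha>(1) yB y in \<open>auto simp: s_def add.commute elim!: eventually_elim2\<close>)
  moreover have "emeasure lborel C \<le> emeasure lborel (B \<inter> {s<..}) + ennreal e"
  proof -
    have "emeasure lborel C \<le> emeasure lborel ((C \<inter> {t. s < x + t}) \<union> {\<gamma>..\<gamma>+e})"
      by (rule emeasure_mono_AE) (use \<gamma>(1) x in \<open>auto simp: s_def elim!: eventually_mono\<close>)
    also have "\<dots> \<le> emeasure lborel (C \<inter> {t. s < x + t}) + emeasure lborel {\<gamma>..\<gamma>+e}"
      by (rule emeasure_subadditive) auto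
    also have "emeasure lborel (C \<inter> {t. s < x + t}) \<le> emeasure lborel (B \<inter> {s<..})"
      by (rule emeasure_le_of_AE_translate[where c=x]) (use xB x in \<open>auto elim!: eventually_mono\<close>)
    finally show ?thesis using e by (simp add: add_right_mono)
  qed
  ultimately have "emeasure lborel A + emeasure lborel C
      \<le> emeasure lborel (B \<inter> {..s}) + emeasure lborel (B \<inter> {s<..}) + ennreal e"
    by (metis add.assoc add_mono)
  also have "emeasure lborel (B \<inter> {..s}) + emeasure lborel (B \<inter> {s<..}) = emeasure lborel B"
    by (subst plus_emeasure) (auto intro!: arg_cong[where f="emeasure lborel"])
  finally show "emeasure lborel A + emeasure lborel C \<le> emeasure lborel B + ennreal e" .
qed

lemma LIMSEQ_emeasure_Int_atLeastAtMost:
  fixes A :: "real set"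
  assumes [measurable]: "A \<in> sets borel"
  shows "(\<lambda>n. emeasure lborel (A \<inter> {- real n..real n})) \<longlonglongrightarrow> emeasure lborel A"
proof -
  have UN: "(\<Union>n. A \<inter> {- real n..real n}) = A"
  proof (intro equalityI subsetI)
    fix x assume "x \<in> A"
    moreover obtain n where "\<bar>x\<bar> \<le> real n" using real_arch_simple by blast
    ultimately show "x \<in> (\<Union>n. A \<inter> {- real n..real n})" by (auto simp: abs_le_iff intro!: exI[of _ n])
  qed auto
  have "range (\<lambda>n. A \<inter> {- real n..real n}) \<subseteq> sets lborel"
    "incseq (\<lambda>n. A \<inter> {- real n..real n})" by (auto simp: incseq_def)
  from Lim_emeasure_incseq[OF this] show ?thesis unfolding UN .
qed

text \<open>Exhaust \<open>A\<close> and \<open>C\<close> by their intersections with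
  \<open>[-n, n]\<close>; these have positive measure for large \<open>n\<close>.\<close>

lemma essential_Brunn_Minkowski:
  fixes A B C :: "real set"
  assumes [measurable]: "A \<in> sets borel" "B \<in> sets borel" "C \<in> sets borel"
    and pos: "0 < emeasure lborel A" "0 < emeasure lborel C"
    and AE1: "AE x in lborel. AE y in lborel. x \<in> A \<and> y \<in> C \<longrightarrow> x + y \<in> B"
    and AE2: "AE y in lborel. AE x in lborel. x \<in> A \<and> y \<in> C \<longrightarrow> x + y \<in> B"
  shows "emeasure lborel A + emeasure lborel C \<le> emeasure lborel B"
proof -
  note lim = LIMSEQ_emeasure_Int_atLeastAtMost
  have "\<forall>\<^sub>F n in sequentially. 0 < emeasure lborel (A \<inter> {- real n..real n})"
    "\<forall>\<^sub>F n in sequentially. 0 < emeasure lborel (C \<inter> {- real n..real n})"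
    using order_tendstoD(1)[OF lim pos(1)] order_tendstoD(1)[OF lim pos(2)] by auto
  then have ev: "\<forall>\<^sub>F n in sequentially.
    emeasure lborel (A \<inter> {- real n..real n}) + emeasure lborel (C \<inter> {- real n..real n}) \<le> emeasure lborel B"
  proof eventually_elim
    case (elim n)
    show ?case
    proof (rule essential_Brunn_Minkowski_bounded)
      show "AE x in lborel. AE y in lborel. x \<in> A \<inter> {- real n..real n} \<and> y \<in> C \<inter> {- real n..real n} \<longrightarrow> x + y \<in> B"
        using AE1 by (auto elim!: eventually_mono)
      show "AE y in lborel. AE x in lborel. x \<in> A \<inter> {- real n..real n} \<and> y \<in> C \<inter> {- real n..real n} \<longrightarrow> x + y \<in> B"
        using AE2 by (auto elim!: eventually_mono)
    qed (use elim in \<open>auto intro: bounded_Int\<close>)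
  qed
  show ?thesis
    by (rule tendsto_upperbound[OF tendsto_add[OF lim lim] ev]) auto
qed

text \<open>Induction on the number of summands. The hypothesis holds only almost everywhere, so the
  sums over \<open>J\<close> are replaced by the set \<open>C\<close> of all \<open>c\<close> for
  which \<open>c + A j\<close> is essentially contained in \<open>B\<close>. Almost all sums over
  \<open>J\<close> lie in \<open>C\<close>, so the induction hypothesis bounds its measure, and the
  two-set inequality applies to \<open>C\<close> and \<open>A j\<close>.\<close>

lemma essential_Brunn_Minkowski_sum:
  fixes A :: "'i \<Rightarrow> real set" and B :: "real set"
  assumes "finite I" "I \<noteq> {}" "\<And>i. i \<in> I \<Longrightarrow> A i \<in> sets borel" "B \<in> sets borel"
    and "\<And>i. i \<in> I \<Longrightarrow> 0 < emeasure lborel (A i)"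
    and "AE x in PiM I (\<lambda>_. lborel). (\<forall>i\<in>I. x i \<in> A i) \<longrightarrow> (\<Sum>i\<in>I. x i) \<in> B"
  shows "(\<Sum>i\<in>I. emeasure lborel (A i)) \<le> emeasure lborel B"
  using assms
proof (induction I arbitrary: B rule: finite_ne_induct)
  case (singleton j)
  have "AE y in lborel. AE X in PiM {} (\<lambda>_::'i. lborel).
      (\<forall>i\<in>{j}. (X(j := y)) i \<in> A i) \<longrightarrow> (\<Sum>i\<in>{j}. (X(j := y)) i) \<in> B"
    using singleton.prems(4) by (intro AE_PiM_insert lborel_power.product_sigma_finite_axioms) auto
  then have "AE y in lborel. y \<in> A j \<longrightarrow> 0 + y \<in> B"
    unfolding PiM_empty by (simp add: AE_count_space)
  from emeasure_le_of_AE_translate[OF _ _ this] singleton.prems show ?case by simp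
next
  case (insert j J)
  note [measurable] = insert.prems(1)[of j, simplified] \<open>B \<in> sets borel\<close>
  have AE: "AE y in lborel. AE X in PiM J (\<lambda>_. lborel). (\<forall>i\<in>insert j J. (X(j := y)) i \<in> A i) \<longrightarrow> (\<Sum>i\<in>insert j J. (X(j := y)) i) \<in> B"
      "AE X in PiM J (\<lambda>_. lborel). AE y in lborel. (\<forall>i\<in>insert j J. (X(j := y)) i \<in> A i) \<longrightarrow> (\<Sum>i\<in>insert j J. (X(j := y)) i) \<in> B"
    using AE_PiM_insert[OF insert.hyps(1) insert.hyps(3) lborel_power.product_sigma_finite_axioms insert.prems(4)] .
  have eq: "(\<forall>i\<in>insert j J. (X(j := y)) i \<in> A i) \<longleftrightarrow> y \<in> A j \<and> (\<forall>i\<in>J. X i \<in> A i)"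
    "(\<Sum>i\<in>insert j J. (X(j := y)) i) = (\<Sum>i\<in>J. X i) + y" for X y
  proof -
    have ne: "i \<noteq> j" if "i \<in> J" for i using that insert.hyps by auto
    then show "(\<forall>i\<in>insert j J. (X(j := y)) i \<in> A i) \<longleftrightarrow> y \<in> A j \<and> (\<forall>i\<in>J. X i \<in> A i)" by auto
    have "(\<Sum>i\<in>J. (X(j := y)) i) = (\<Sum>i\<in>J. X i)" using ne by (intro sum.cong) auto
    then show "(\<Sum>i\<in>insert j J. (X(j := y)) i) = (\<Sum>i\<in>J. X i) + y" using insert.hyps by simp
  qed
  define C where "C = {c. AE y in lborel. y \<in> A j \<longrightarrow> c + y \<in> B}"
  have Bc[measurable]: "- B \<in> sets borel" using \<open>B \<in> sets borel\<close> by auto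
  \<comment> \<open>Membership becomes the vanishing of an integral that depends measurably on
    \<open>c\<close>, which makes \<open>C\<close> a Borel set.\<close>
  have "c \<in> C \<longleftrightarrow> (\<integral>\<^sup>+y. indicator (A j) y * indicator (- B) (c + y) \<partial>lborel) = 0" for c
  proof -
    have "(\<integral>\<^sup>+y. indicator (A j) y * indicator (- B) (c + y) \<partial>lborel) = 0
        \<longleftrightarrow> (AE y in lborel. indicator (A j) y * indicator (- B) (c + y) = (0::ennreal))"
      by (rule nn_integral_0_iff_AE) measurable
    also have "(\<lambda>y. indicator (A j) y * indicator (- B) (c + y) = (0::ennreal)) = (\<lambda>y. y \<in> A j \<longrightarrow> c + y \<in> B)"
      by (auto simp: fun_eq_iff indicator_def)
    finally show ?thesis by (simp add: C_def)
  qed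
  then have "C = {c \<in> space borel. (\<integral>\<^sup>+y. indicator (A j) y * indicator (- B) (c + y) \<partial>lborel) = 0}"
    by auto
  also have "\<dots> \<in> sets borel" by measurable
  finally have C[measurable]: "C \<in> sets borel" .
  have "AE X in PiM J (\<lambda>_. lborel). (\<forall>i\<in>J. X i \<in> A i) \<longrightarrow> (\<Sum>i\<in>J. X i) \<in> C"
    using AE(2) unfolding eq by eventually_elim (auto simp: C_def)
  then have le: "(\<Sum>i\<in>J. emeasure lborel (A i)) \<le> emeasure lborel C"
    using insert by (intro insert.IH) auto
  obtain i where "i \<in> J" using \<open>J \<noteq> {}\<close> by auto
  then have "0 < emeasure lborel (A i)" using insert.prems(3) by auto
  also have "\<dots> \<le> (\<Sum>i\<in>J. emeasure lborel (A i))"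
    using \<open>i \<in> J\<close> \<open>finite J\<close> by (intro member_le_sum) auto
  finally have Cpos: "0 < emeasure lborel C" using le by simp
  have "AE y in lborel. c \<in> C \<and> y \<in> A j \<longrightarrow> c + y \<in> B" for c
    by (cases "c \<in> C") (auto simp: C_def)
  then have AE2: "AE c in lborel. AE y in lborel. c \<in> C \<and> y \<in> A j \<longrightarrow> c + y \<in> B" by simp
  then have AE1: "AE y in lborel. AE c in lborel. c \<in> C \<and> y \<in> A j \<longrightarrow> c + y \<in> B"
    by (subst lborel_pair.AE_commute) measurable
  have "(\<Sum>i\<in>J. emeasure lborel (A i)) + emeasure lborel (A j) \<le> emeasure lborel C + emeasure lborel (A j)"
    using le by (intro add_right_mono)
  also have "\<dots> \<le> emeasure lborel B"
    by (rule essential_Brunn_Minkowski[OF _ _ _ Cpos _ AE2 AE1]) (use insert.prems in auto)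
  finally show ?case
    using insert.hyps by (simp add: add.commute)
qed

section \<open>Lebesgue measure on vectors as a product measure\<close>

lemma measurable_vec_lambda [measurable]:
  "vec_lambda \<in> PiM UNIV (\<lambda>_. lborel) \<rightarrow>\<^sub>M (borel :: ('a::euclidean_space ^ 'm::finite) measure)"
proof (subst borel_measurable_euclidean_space, rule ballI)
  fix b :: "'a ^ 'm" assume "b \<in> Basis"
  then obtain i u where b: "b = axis i u" by (auto simp: Basis_vec_def)
  show "(\<lambda>x. vec_lambda x \<bullet> b) \<in> borel_measurable (PiM UNIV (\<lambda>_. lborel))"
    unfolding b inner_axis vec_lambda_beta by measurable
qed

text \<open>Lebesgue measure is determined by its values on boxes. The basis vectors are
  \<open>axis i b\<close>, so a box is the product of the boxes of its components. Components are
  real numbers in some uses and vectors in others.\<close>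

lemma lborel_vec_eq_distr_PiM:
  "(lborel :: ('a::euclidean_space ^ 'm::finite) measure) = distr (PiM UNIV (\<lambda>_. lborel)) borel vec_lambda"
proof (rule lborel_eqI)
  fix l u :: "'a ^ 'm" assume lu: "\<And>b. b \<in> Basis \<Longrightarrow> l \<bullet> b \<le> u \<bullet> b"
  have lu': "l $ i \<bullet> b \<le> u $ i \<bullet> b" if "b \<in> Basis" for i b
    using lu[of "axis i b"] that by (auto simp: Basis_vec_def inner_axis)
  have eq: "vec_lambda -` box l u \<inter> space (PiM UNIV (\<lambda>_. lborel)) = (\<Pi>\<^sub>E i\<in>UNIV. box (l $ i) (u $ i))"
    by (auto simp: box_def Basis_vec_def inner_axis space_PiM PiE_iff)
  have Basis: "Basis = (\<lambda>(i, b). axis i b) ` (UNIV \<times> Basis :: ('m \<times> 'a) set)"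
    by (auto simp: Basis_vec_def)
  have inj: "inj_on (\<lambda>(i, b). axis i b) (UNIV \<times> Basis :: ('m \<times> 'a) set)"
    by (auto simp: inj_on_def axis_eq_axis)
  have "emeasure (distr (PiM UNIV (\<lambda>_. lborel)) borel vec_lambda) (box l u)
      = (\<Prod>i\<in>UNIV. emeasure lborel (box (l $ i) (u $ i)))"
    by (subst emeasure_distr) (auto simp: eq lborel_power.emeasure_PiM)
  also have "\<dots> = (\<Prod>i\<in>UNIV. ennreal (\<Prod>b\<in>Basis. (u $ i - l $ i) \<bullet> b))"
    using lu' by simp
  also have "\<dots> = ennreal (\<Prod>i\<in>UNIV. \<Prod>b\<in>Basis. (u $ i - l $ i) \<bullet> b)"
    using lu' by (intro prod_ennreal prod_nonneg) (auto simp: inner_diff_left)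
  also have "(\<Prod>i\<in>UNIV. \<Prod>b\<in>Basis. (u $ i - l $ i) \<bullet> b) = prod ((\<bullet>) (u - l)) Basis"
    unfolding Basis by (subst prod.reindex[OF inj])
      (simp add: prod.cartesian_product inner_axis split_beta)
  finally show "emeasure (distr (PiM UNIV (\<lambda>_. lborel)) borel vec_lambda) (box l u)
      = ennreal (prod ((\<bullet>) (u - l)) Basis)" .
qed simp

lemma AE_PiM_of_AE_lborel_vec:
  fixes P :: "'a::euclidean_space ^ 'm::finite \<Rightarrow> bool"
  assumes "AE x in lborel. P x"
  shows "AE X in PiM UNIV (\<lambda>_. lborel). P (vec_lambda X)"
  using assms unfolding lborel_vec_eq_distr_PiM by (rule AE_distrD[OF measurable_vec_lambda])

section \<open>Layer-cake formula, scaling and truncation levels\<close>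

lemma nn_integral_layer_cake:
  fixes v :: "'a \<Rightarrow> real"
  assumes M: "sigma_finite_measure M" and [measurable]: "v \<in> borel_measurable M"
  shows "(\<integral>\<^sup>+x. ennreal (v x) \<partial>M) = (\<integral>\<^sup>+s. indicator {0<..} s * emeasure M {x \<in> space M. s \<le> v x} \<partial>lborel)"
proof -
  interpret M: sigma_finite_measure M by fact
  interpret P: pair_sigma_finite M "lborel :: real measure" ..
  have "ennreal (v x) = (\<integral>\<^sup>+s. indicator {0<..} s * indicator {y \<in> space M. s \<le> v y} x \<partial>lborel)"
    if "x \<in> space M" for x
  proof -
    have "(\<integral>\<^sup>+s. indicator {0<..} s * indicator {y \<in> space M. s \<le> v y} x \<partial>lborel)
      = (\<integral>\<^sup>+s. indicator {0<..v x} s \<partial>lborel)"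
      using that by (intro nn_integral_cong) (auto simp: indicator_def)
    \<comment> \<open>For negative \<open>v x\<close> both sides are 0, since \<open>ennreal\<close>
      truncates at 0.\<close>
    also have "\<dots> = ennreal (v x)"
      by (cases "0 \<le> v x") (auto simp: ennreal_neg)
    finally show ?thesis by simp
  qed
  then have "(\<integral>\<^sup>+x. ennreal (v x) \<partial>M)
      = (\<integral>\<^sup>+x. \<integral>\<^sup>+s. indicator {0<..} s * indicator {y \<in> space M. s \<le> v y} x \<partial>lborel \<partial>M)"
    by (intro nn_integral_cong) auto
  also have "\<dots> = (\<integral>\<^sup>+s. \<integral>\<^sup>+x. indicator {0<..} s * indicator {y \<in> space M. s \<le> v y} x \<partial>M \<partial>lborel)"
    by (rule P.Fubini'[symmetric]) measurable
  also have "\<dots> = (\<integral>\<^sup>+s. indicator {0<..} s * emeasure M {x \<in> space M. s \<le> v x} \<partial>lborel)"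
    by (simp add: nn_integral_cmult)
  finally show ?thesis .
qed

lemma emeasure_lborel_scale:
  fixes A :: "real set"
  assumes A[measurable]: "A \<in> sets borel" and c: "0 < c"
  shows "emeasure lborel {y. y / c \<in> A} = ennreal c * emeasure lborel A"
proof -
  have m: "{y. y / c \<in> A} \<in> sets borel"
    using measurable_sets[of "\<lambda>y. y / c" borel borel A] by (simp add: vimage_def)
  have "emeasure lborel {y. y / c \<in> A} = (\<integral>\<^sup>+y. indicator {y. y / c \<in> A} y \<partial>lborel)"
    using m by simp
  also have "\<dots> = ennreal \<bar>c\<bar> * (\<integral>\<^sup>+x. indicator {y. y / c \<in> A} (0 + c * x) \<partial>lborel)"
    using m c by (intro nn_integral_real_affine) auto
  also have "(\<integral>\<^sup>+x. indicator {y. y / c \<in> A} (0 + c * x) \<partial>lborel) = (\<integral>\<^sup>+x. indicator A x \<partial>lborel)"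
    using c by (intro nn_integral_cong) (auto simp: indicator_def)
  finally show ?thesis using c by simp
qed

text \<open>The levels increase to the essential supremum of \<open>f\<close>, which may be
  infinite. Staying strictly below it gives \<open>{x. c n \<le> f x}\<close> positive measure, and
  reaching it in the limit gives convergence of the truncated integrals, dominated by
  \<open>f\<close>.\<close>

lemma ex_truncation_levels:
  fixes f :: "real \<Rightarrow> real"
  assumes f: "integrable lborel f" "\<And>x. 0 \<le> f x" "0 < (LINT x|lborel. f x)"
  obtains c :: "nat \<Rightarrow> real" where "\<And>n. 0 < c n"
    and "\<And>n. 0 < emeasure lborel {x. c n \<le> f x}"
    and "(\<lambda>n. LINT x|lborel. min (f x) (c n)) \<longlonglongrightarrow> (LINT x|lborel. f x)"
proof -
  have [measurable]: "f \<in> borel_measurable borel" using borel_measurable_integrable[OF f(1)] by simp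
  define e where "e = esssup lborel (\<lambda>x. ereal (f x))"
  have AE: "AE x in lborel. ereal (f x) \<le> e" unfolding e_def by (rule esssup_AE)
  have "0 < e"
  proof (rule ccontr)
    assume "\<not> 0 < e"
    then have e: "e \<le> 0" by simp
    have "AE x in lborel. f x = 0"
      using AE
    proof eventually_elim
      case (elim x)
      have "ereal (f x) \<le> 0" using elim e by (rule order_trans)
      then show ?case using f(2)[of x] by simp
    qed
    then have "(LINT x|lborel. f x) = 0" by (rule integral_eq_zero_AE)
    then show False using f(3) by simp
  qed
  then obtain c where c: "\<And>n::nat. 0 < ereal (c n)" "\<And>n. ereal (c n) < e" "(\<lambda>n. ereal (c n)) \<longlonglongrightarrow> e"
    by (rule ereal_incseq_approx) auto
  show ?thesis
  proof
    show "0 < c n" for n using c(1)[of n] by simp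
    show "0 < emeasure lborel {x. c n \<le> f x}" for n
    proof -
      have "0 < emeasure lborel {x \<in> space lborel. ereal (c n) < ereal (f x)}"
        using c(2)[of n] by (intro esssup_pos_measure) (simp_all add: e_def)
      also have "\<dots> \<le> emeasure lborel {x. c n \<le> f x}"
        by (intro emeasure_mono) auto
      finally show ?thesis .
    qed
    show "(\<lambda>n. LINT x|lborel. min (f x) (c n)) \<longlonglongrightarrow> (LINT x|lborel. f x)"
    proof (rule integral_dominated_convergence[where w=f])
      show "AE x in lborel. (\<lambda>n. min (f x) (c n)) \<longlonglongrightarrow> f x"
        using AE
      proof eventually_elim
        case (elim x)
        have "(\<lambda>n. min (ereal (f x)) (ereal (c n))) \<longlonglongrightarrow> min (ereal (f x)) e"
          by (intro tendsto_min tendsto_const c(3))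
        then show ?case using elim by (simp add: min_absorb1 flip: ereal_min)
      qed
      show "AE x in lborel. norm (min (f x) (c n)) \<le> f x" for n
        using f(2) c(1)[of n] by (auto simp: abs_le_iff min_def)
    qed (use f(1) in auto)
  qed
qed

section \<open>The one-dimensional inequality\<close>

text \<open>The substitution \<open>X i = w i * x i\<close> turns the weighted average into a plain
  sum, the form that \<open>essential_Brunn_Minkowski_sum\<close> handles.\<close>

lemma AE_PiM_scaled_coordinates:
  fixes w :: "'m::finite \<Rightarrow> real" and P :: "real ^ 'm \<Rightarrow> bool"
  assumes w: "\<And>i. 0 < w i" and P: "AE x in lborel. P x"
  shows "AE X in PiM UNIV (\<lambda>_. lborel). P (\<chi> i. X i / w i)"
proof -
  define h :: "real ^ 'm \<Rightarrow> real ^ 'm" where "h y = (\<chi> i. y $ i / w i)" for y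
  have "linear h" by (auto simp: linear_iff h_def vec_eq_iff add_divide_distrib)
  moreover have "surj h"
    using w by (intro surjI[of _ "\<lambda>y. \<chi> i. y $ i * w i"])
      (simp add: h_def vec_eq_iff less_imp_neq[symmetric])
  ultimately have "AE y in lborel. P (h y)" by (rule AE_lborel_linear_surj[OF _ _ P])
  from AE_PiM_of_AE_lborel_vec[OF this] show ?thesis by (simp add: h_def)
qed

text \<open>Truncating \<open>f i\<close> at \<open>c i\<close> and dividing by \<open>c i\<close>
  gives all functions the same maximal height 1, attained on a set of positive measure. Superlevel
  sets at a common height are then all of positive measure or all empty, so Brunn-Minkowski can be
  used at every height.\<close>

lemma one_dim_arithmetic_truncated:
  fixes w c :: "'m::finite \<Rightarrow> real" and f g :: "'m \<Rightarrow> real \<Rightarrow> real"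
  assumes w: "\<And>i. 0 < w i"
    and f: "\<And>i x. 0 \<le> f i x" "\<And>i. integrable lborel (f i)"
    and g: "\<And>i x. 0 \<le> g i x" "\<And>i. integrable lborel (g i)"
    and K: "0 < K"
    and c: "\<And>i. 0 < c i" "\<And>i. 0 < emeasure lborel {x. c i \<le> f i x}"
    and AE: "AE x in (lborel :: (real ^ 'm) measure). (\<forall>i. 0 < f i (x $ i)) \<longrightarrow>
      K \<le> (\<Sum>i\<in>UNIV. w i * (g i (\<Sum>k\<in>UNIV. w k * x $ k) / f i (x $ i)))"
  shows "K * (\<Sum>i\<in>UNIV. w i / c i * (LINT x|lborel. min (f i x) (c i)))
    \<le> (\<Sum>i\<in>UNIV. w i / c i * (LINT x|lborel. g i x))"
proof -
  have [measurable]: "f i \<in> borel_measurable borel" "g i \<in> borel_measurable borel" for i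
    using borel_measurable_integrable[OF f(2)] borel_measurable_integrable[OF g(2)] by auto
  have w0: "0 \<le> w i" for i using w[of i] by simp
  have c0: "0 \<le> c i" "c i \<noteq> 0" for i using c(1)[of i] by auto
  define u where "u i x = min (f i x / c i) 1" for i x
  define h where "h z = (\<Sum>i\<in>UNIV. w i * (g i z / c i)) / K" for z
  have [measurable]: "u i \<in> borel_measurable borel" "h \<in> borel_measurable borel" for i
    unfolding u_def h_def by measurable
  have u0: "0 \<le> u i x" for i x using f(1) c0 by (simp add: u_def)
  have h0: "0 \<le> h x" for x using g(1) c0 w0 K by (auto simp: h_def intro!: sum_nonneg divide_nonneg_nonneg)
  have level: "(\<Sum>i\<in>UNIV. ennreal (w i) * emeasure lborel {x. s \<le> u i x}) \<le> emeasure lborel {z. s \<le> h z}"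
    if s: "0 < s" for s
  proof (cases "s \<le> 1")
    case False
    then have "{x. s \<le> u i x} = {}" for i by (auto simp: u_def)
    then show ?thesis by simp
  next
    case True
    \<comment> \<open>This is the superlevel set dilated by \<open>w i\<close>: the dilation
      accounts for the weight both in the average and in the measure.\<close>
    define A where "A i = {y. y / w i \<in> {x. s \<le> u i x}}" for i
    have Au: "{x. s \<le> u i x} \<in> sets borel" for i by measurable
    have Am: "A i \<in> sets borel" for i
      using measurable_sets[of "\<lambda>y. y / w i" borel borel "{x. s \<le> u i x}"] Au by (simp add: A_def vimage_def)
    have eA: "emeasure lborel (A i) = ennreal (w i) * emeasure lborel {x. s \<le> u i x}" for i
      unfolding A_def using emeasure_lborel_scale[OF Au w] by simp
    have "{x. c i \<le> f i x} \<subseteq> {x. s \<le> u i x}" for i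
      using True c(1)[of i] by (auto simp: u_def intro: order_trans)
    then have "emeasure lborel {x. c i \<le> f i x} \<le> emeasure lborel {x. s \<le> u i x}" for i
      using Au by (intro emeasure_mono) auto
    then have "0 < emeasure lborel {x. s \<le> u i x}" for i
      using c(2)[of i] by (rule less_le_trans[rotated])
    then have Apos: "0 < emeasure lborel (A i)" for i
      unfolding eA using w[of i] by (simp add: ennreal_zero_less_mult_iff)
    have "AE X in PiM UNIV (\<lambda>_. lborel). (\<forall>i\<in>UNIV. X i \<in> A i) \<longrightarrow> (\<Sum>i\<in>UNIV. X i) \<in> {z. s \<le> h z}"
      using AE_PiM_scaled_coordinates[of w, OF w AE]
    proof eventually_elim
      case (elim X)
      show ?case
      proof
        assume X: "\<forall>i\<in>UNIV. X i \<in> A i"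
        define z where "z = (\<Sum>i\<in>UNIV. X i)"
        have le: "c i * s \<le> f i (X i / w i)" for i
        proof -
          have "s \<le> f i (X i / w i) / c i" using X by (auto simp: A_def u_def)
          then show ?thesis using c(1)[of i] by (simp add: pos_le_divide_eq mult.commute)
        qed
        have cs: "0 < c i * s" for i using c(1)[of i] s by simp
        have "0 < f i (X i / w i)" for i using less_le_trans[OF cs le] .
        then have "K \<le> (\<Sum>i\<in>UNIV. w i * (g i z / f i (X i / w i)))"
          using elim w by (simp add: z_def less_imp_neq[symmetric])
        \<comment> \<open>Replacing \<open>f i\<close> by its lower bound \<open>c i * s\<close>
          leaves an estimate in \<open>z\<close> and \<open>s\<close> alone, which after division by
          \<open>K\<close> reads \<open>s \<le> h z\<close>.\<close>
        also have "\<dots> \<le> (\<Sum>i\<in>UNIV. w i * (g i z / (c i * s)))"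
          using w0 g(1) le s c(1) less_le_trans[OF cs le]
          by (intro sum_mono mult_left_mono divide_left_mono mult_pos_pos) auto
        also have "\<dots> = (\<Sum>i\<in>UNIV. w i * (g i z / c i)) / s"
          by (simp add: sum_divide_distrib)
        finally have "s \<le> h z" using s K by (simp add: h_def field_simps)
        then show "(\<Sum>i\<in>UNIV. X i) \<in> {z. s \<le> h z}" by (simp add: z_def)
      qed
    qed
    then have "(\<Sum>i\<in>UNIV. emeasure lborel (A i)) \<le> emeasure lborel {z. s \<le> h z}"
      using Am Apos by (intro essential_Brunn_Minkowski_sum) auto
    then show ?thesis by (simp add: eA)
  qed
  have cake: "(\<integral>\<^sup>+x. ennreal (v x) \<partial>lborel) = (\<integral>\<^sup>+s. indicator {0<..} s * emeasure lborel {x. s \<le> v x} \<partial>lborel)"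
    if "v \<in> borel_measurable borel" for v :: "real \<Rightarrow> real"
    using nn_integral_layer_cake[of lborel v] that lborel.sigma_finite_measure_axioms by simp
  have "(\<Sum>i\<in>UNIV. ennreal (w i) * (\<integral>\<^sup>+x. ennreal (u i x) \<partial>lborel))
    = (\<Sum>i\<in>UNIV. \<integral>\<^sup>+s. ennreal (w i) * (indicator {0<..} s * emeasure lborel {x. s \<le> u i x}) \<partial>lborel)"
    by (simp add: cake nn_integral_cmult)
  also have "\<dots> = (\<integral>\<^sup>+s. (\<Sum>i\<in>UNIV. ennreal (w i) * (indicator {0<..} s * emeasure lborel {x. s \<le> u i x})) \<partial>lborel)"
    by (simp add: nn_integral_sum)
  also have "\<dots> \<le> (\<integral>\<^sup>+s. indicator {0<..} s * emeasure lborel {z. s \<le> h z} \<partial>lborel)"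
    using level by (intro nn_integral_mono) (auto simp: indicator_def)
  also have "\<dots> = (\<integral>\<^sup>+z. ennreal (h z) \<partial>lborel)"
    by (simp add: cake)
  finally have le: "(\<Sum>i\<in>UNIV. ennreal (w i) * (\<integral>\<^sup>+x. ennreal (u i x) \<partial>lborel)) \<le> (\<integral>\<^sup>+z. ennreal (h z) \<partial>lborel)" .
  have inth: "integrable lborel h"
    unfolding h_def using g(2) by simp
  have intu: "integrable lborel (u i)" for i
    by (rule Bochner_Integration.integrable_bound[of lborel "\<lambda>x. f i x / c i"])
       (use f u0 c0 in \<open>auto simp: u_def\<close>)
  have "(\<Sum>i\<in>UNIV. ennreal (w i) * (\<integral>\<^sup>+x. ennreal (u i x) \<partial>lborel))
      = (\<Sum>i\<in>UNIV. ennreal (w i * (LINT x|lborel. u i x)))"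
    using u0 w0 by (simp add: nn_integral_eq_integral[OF intu] ennreal_mult integral_nonneg)
  also have "\<dots> = ennreal (\<Sum>i\<in>UNIV. w i * (LINT x|lborel. u i x))"
    using u0 w0 by (intro sum_ennreal) (auto intro!: mult_nonneg_nonneg integral_nonneg)
  finally have "ennreal (\<Sum>i\<in>UNIV. w i * (LINT x|lborel. u i x)) \<le> ennreal (LINT z|lborel. h z)"
    using le h0 by (simp add: nn_integral_eq_integral[OF inth])
  then have "(\<Sum>i\<in>UNIV. w i * (LINT x|lborel. u i x)) \<le> (LINT z|lborel. h z)"
    using h0 by (simp add: integral_nonneg)
  moreover have "(LINT x|lborel. u i x) = (LINT x|lborel. min (f i x) (c i)) / c i" for i
  proof -
    have "u i x = min (f i x) (c i) / c i" for x using c(1)[of i] by (auto simp: u_def min_def field_simps)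
    then show ?thesis by simp
  qed
  moreover have "(LINT z|lborel. h z) = (\<Sum>i\<in>UNIV. w i * ((LINT x|lborel. g i x) / c i)) / K"
    unfolding h_def using g(2) by simp
  ultimately show ?thesis using K by (simp add: field_simps)
qed

text \<open>If all the ratios of integrals were below \<open>K\<close>, the finitely many strict
  inequalities would survive truncation at a common index \<open>n\<close>. Their sum with weights
  \<open>w i / c i n\<close> contradicts the truncated inequality.\<close>

lemma one_dim_arithmetic:
  fixes w :: "'m::finite \<Rightarrow> real" and f g :: "'m \<Rightarrow> real \<Rightarrow> real"
  assumes w: "\<And>i. 0 < w i"
    and f: "\<And>i x. 0 \<le> f i x" "\<And>i. integrable lborel (f i)" "\<And>i. 0 < (LINT x|lborel. f i x)"
    and g: "\<And>i x. 0 \<le> g i x" "\<And>i. integrable lborel (g i)"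
    and K: "0 < K"
    and AE: "AE x in (lborel :: (real ^ 'm) measure). (\<forall>i. 0 < f i (x $ i)) \<longrightarrow>
      K \<le> (\<Sum>i\<in>UNIV. w i * (g i (\<Sum>k\<in>UNIV. w k * x $ k) / f i (x $ i)))"
  obtains i where "K * (LINT x|lborel. f i x) \<le> (LINT x|lborel. g i x)"
proof (rule ccontr)
  assume *: "\<not> thesis"
  have neg: "(LINT x|lborel. g i x) < K * (LINT x|lborel. f i x)" for i
    using * that[of i] by (meson not_le)
  have "\<exists>c. (\<forall>n::nat. 0 < c n) \<and> (\<forall>n. 0 < emeasure lborel {x. c n \<le> f i x}) \<and>
     (\<lambda>n. LINT x|lborel. min (f i x) (c n)) \<longlonglongrightarrow> (LINT x|lborel. f i x)" for i
    by (rule ex_truncation_levels[OF f(2) f(1) f(3)]) blast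
  then obtain c where c: "\<And>i (n::nat). 0 < c i n" "\<And>i n. 0 < emeasure lborel {x. c i n \<le> f i x}"
    "\<And>i. (\<lambda>n. LINT x|lborel. min (f i x) (c i n)) \<longlonglongrightarrow> (LINT x|lborel. f i x)"
    by metis
  have "(\<lambda>n. K * (LINT x|lborel. min (f i x) (c i n))) \<longlonglongrightarrow> K * (LINT x|lborel. f i x)" for i
    by (intro tendsto_intros c(3))
  from order_tendstoD(1)[OF this neg]
  have "\<forall>\<^sub>F n in sequentially. \<forall>i. (LINT x|lborel. g i x) < K * (LINT x|lborel. min (f i x) (c i n))"
    by (simp add: eventually_all_finite)
  then obtain n where n: "\<And>i. (LINT x|lborel. g i x) < K * (LINT x|lborel. min (f i x) (c i n))"
    by (auto simp: eventually_sequentially)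
  have "(\<Sum>i\<in>UNIV. w i / c i n * (LINT x|lborel. g i x))
     < (\<Sum>i\<in>UNIV. w i / c i n * (K * (LINT x|lborel. min (f i x) (c i n))))"
    using n w c(1) by (intro sum_strict_mono mult_strict_left_mono) auto
  also have "\<dots> = K * (\<Sum>i\<in>UNIV. w i / c i n * (LINT x|lborel. min (f i x) (c i n)))"
    by (simp add: sum_distrib_left algebra_simps)
  also have "\<dots> \<le> (\<Sum>i\<in>UNIV. w i / c i n * (LINT x|lborel. g i x))"
    by (rule one_dim_arithmetic_truncated[OF w f(1,2) g K c(1,2) AE])
  finally show False by simp
qed

text \<open>Reduction to the arithmetic mean: replace \<open>g i\<close> by
  \<open>M * g i / \<alpha> i\<close>, with \<alpha> the perturbed ratios of integrals and
  \<open>M\<close> their mean of exponent \<open>Q_1(p)\<close>. Hoelder turns the hypothesis into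
  the one for exponent 1 with the same \<open>K\<close>.\<close>

lemma one_dim_power_mean:
  fixes w :: "'m::finite \<Rightarrow> real" and f g :: "'m \<Rightarrow> real \<Rightarrow> real"
  assumes w: "weight w" and p: "p \<le> 1"
    and f: "\<And>i x. 0 \<le> f i x" "\<And>i. integrable lborel (f i)" "\<And>i. 0 < (LINT x|lborel. f i x)"
    and g: "\<And>i x. 0 \<le> g i x" "\<And>i. integrable lborel (g i)"
    and AE: "AE x in (lborel :: (real ^ 'm) measure). (\<forall>i. 0 < f i (x $ i)) \<longrightarrow>
      K \<le> power_mean p w (\<lambda>i. g i (\<Sum>k\<in>UNIV. w k * x $ k) / f i (x $ i))"
  shows "K \<le> power_mean (power_transform 1 p) w (\<lambda>i. (LINT x|lborel. g i x) / (LINT x|lborel. f i x))"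
proof (cases "0 < K")
  case False
  have "0 \<le> power_mean (power_transform 1 p) w (\<lambda>i. (LINT x|lborel. g i x) / (LINT x|lborel. f i x))"
    using f g by (intro power_mean_nonneg divide_nonneg_nonneg integral_nonneg) auto
  then show ?thesis using False by linarith
next
  case K: True
  let ?q = "power_transform 1 p"
  have G0: "0 \<le> (LINT x|lborel. g i x)" for i using g by (simp add: integral_nonneg)
  have F0: "0 \<le> (LINT x|lborel. f i x)" for i using f by (simp add: integral_nonneg)
  have w0: "0 < w i" for i using w by (simp add: weight_def)
  show ?thesis
  proof (rule power_mean_le_of_perturbation[OF w])
    fix e :: real assume e: "0 < e"
    \<comment> \<open>The summand \<open>e\<close> makes \<alpha> positive, as Hoelder requires, and
      makes \<open>\<alpha> i\<close> times the integral of \<open>f i\<close> strictly exceed the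
      integral of \<open>g i\<close>, which gives the final contradiction.\<close>
    define \<alpha> where "\<alpha> i = (LINT x|lborel. g i x) / (LINT x|lborel. f i x) + e" for i
    have \<alpha>: "0 < \<alpha> i" for i unfolding \<alpha>_def using G0 f(3)[of i] e by (intro add_nonneg_pos) auto
    have \<alpha>0: "0 \<le> \<alpha> i" "\<alpha> i \<noteq> 0" for i using \<alpha>[of i] by auto
    define M where "M = power_mean ?q w \<alpha>"
    have M0: "0 \<le> M" unfolding M_def by (rule power_mean_nonneg) (rule \<alpha>0)
    show "K \<le> power_mean ?q w (\<lambda>i. (LINT x|lborel. g i x) / (LINT x|lborel. f i x) + e)"
    proof (rule ccontr)
      assume "\<not> ?thesis"
      then have MK: "M < K" by (simp add: M_def \<alpha>_def[abs_def])
      have "AE x in (lborel :: (real ^ 'm) measure). (\<forall>i. 0 < f i (x $ i)) \<longrightarrow>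
        K \<le> (\<Sum>i\<in>UNIV. w i * ((M * g i (\<Sum>k\<in>UNIV. w k * x $ k) / \<alpha> i) / f i (x $ i)))"
        using AE
      proof eventually_elim
        case (elim x)
        show ?case
        proof
          assume pos: "\<forall>i. 0 < f i (x $ i)"
          let ?z = "\<Sum>k\<in>UNIV. w k * x $ k"
          have "K \<le> power_mean p w (\<lambda>i. \<alpha> i * (g i ?z / \<alpha> i / f i (x $ i)))"
            using elim pos \<alpha>0 by simp
          also have "\<dots> \<le> M * (\<Sum>i\<in>UNIV. w i * (g i ?z / \<alpha> i / f i (x $ i)))"
            unfolding M_def by (rule power_mean_mult_le[OF w p \<alpha>]) (simp add: \<alpha>0 g f)
          finally show "K \<le> (\<Sum>i\<in>UNIV. w i * ((M * g i ?z / \<alpha> i) / f i (x $ i)))"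
            by (simp add: sum_distrib_left algebra_simps)
        qed
      qed
      then obtain i where "K * (LINT x|lborel. f i x) \<le> (LINT x|lborel. M * g i x / \<alpha> i)"
        by (rule one_dim_arithmetic[OF w0 f _ _ K, rotated 2])
           (use g M0 \<alpha>0 in auto)
      then have "K * (LINT x|lborel. f i x) * \<alpha> i \<le> M * (LINT x|lborel. g i x)"
        using \<alpha>[of i] by (simp add: pos_le_divide_eq)
      also have "\<dots> \<le> K * (LINT x|lborel. g i x)"
        using MK G0 by (intro mult_right_mono) auto
      finally have "(LINT x|lborel. f i x) * \<alpha> i \<le> (LINT x|lborel. g i x)"
        using K by (simp add: mult.assoc)
      moreover have "(LINT x|lborel. f i x) * \<alpha> i = (LINT x|lborel. g i x) + (LINT x|lborel. f i x) * e"
        using f(3)[of i] by (simp add: \<alpha>_def algebra_simps)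
      ultimately show False using f(3)[of i] e by (simp add: mult_le_0_iff)
    qed
  qed (use G0 F0 in auto)
qed

section \<open>Higher dimensions\<close>

lemma integrable_PiM_insert:
  fixes f :: "('i \<Rightarrow> 'a) \<Rightarrow> real"
  assumes J: "finite J" "j \<notin> J" and M: "product_sigma_finite M"
    and f: "integrable (PiM (insert j J) M) f"
  shows "AE y in M j. integrable (PiM J M) (\<lambda>X. f (X(j := y)))"
    and "integrable (M j) (\<lambda>y. LINT X|PiM J M. f (X(j := y)))"
    and "(LINT X|PiM (insert j J) M. f X) = (LINT y|M j. LINT X|PiM J M. f (X(j := y)))"
proof -
  interpret product_sigma_finite M by fact
  interpret S: sigma_finite_measure "PiM J M" by (rule sigma_finite[OF J(1)])
  interpret P: pair_sigma_finite "M j" "PiM J M" ..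
  have m: "(\<lambda>(y, X). X(j := y)) \<in> M j \<Otimes>\<^sub>M PiM J M \<rightarrow>\<^sub>M PiM (insert j J) M"
    by measurable
  have fm: "f \<in> borel_measurable (PiM (insert j J) M)" using f by auto
  have int: "integrable (M j \<Otimes>\<^sub>M PiM J M) (\<lambda>z. f ((\<lambda>(y, X). X(j := y)) z))"
    using f by (subst (asm) PiM_insert_eq_distr[OF J M]) (simp add: integrable_distr_eq[OF m fm])
  show "AE y in M j. integrable (PiM J M) (\<lambda>X. f (X(j := y)))"
    using P.AE_integrable_fst'[OF int] by simp
  show "integrable (M j) (\<lambda>y. LINT X|PiM J M. f (X(j := y)))"
    using P.integrable_fst'[OF int] by simp
  have "(LINT X|PiM (insert j J) M. f X) = (LINT z|(M j \<Otimes>\<^sub>M PiM J M). f ((\<lambda>(y, X). X(j := y)) z))"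
    by (subst PiM_insert_eq_distr[OF J M]) (rule integral_distr[OF m fm])
  also have "\<dots> = (LINT y|M j. LINT X|PiM J M. f (X(j := y)))"
    using P.integral_fst'[OF int] by simp
  finally show "(LINT X|PiM (insert j J) M. f X) = (LINT y|M j. LINT X|PiM J M. f (X(j := y)))" .
qed

text \<open>The exponent is an iterate of \<open>Q\<^sub>1\<close> because \<open>power_transform 0\<close> is not the identity (\<open>1 / 0 = 0\<close>),
  while the induction starts at \<open>J = {}\<close>.\<close>

lemma power_mean_integral_PiM:
  fixes w :: "'m::finite \<Rightarrow> real" and f g :: "'m \<Rightarrow> ('d \<Rightarrow> real) \<Rightarrow> real" and J :: "'d set"
  assumes w: "weight w" and J: "finite J"
    and p: "\<And>k. k < card J \<Longrightarrow> (power_transform 1 ^^ k) p \<le> 1"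
    and f: "\<And>i x. 0 \<le> f i x" "\<And>i. integrable (PiM J (\<lambda>_. lborel)) (f i)"
      "\<And>i. 0 < (LINT x|PiM J (\<lambda>_. lborel). f i x)"
    and g: "\<And>i x. 0 \<le> g i x" "\<And>i. integrable (PiM J (\<lambda>_. lborel)) (g i)"
    and AE: "AE X in PiM J (\<lambda>_. lborel :: (real ^ 'm) measure).
      (\<forall>i. 0 < f i (\<lambda>j\<in>J. X j $ i)) \<longrightarrow>
      K \<le> power_mean p w (\<lambda>i. g i (\<lambda>j\<in>J. \<Sum>k\<in>UNIV. w k * X j $ k) / f i (\<lambda>j\<in>J. X j $ i))"
  shows "K \<le> power_mean ((power_transform 1 ^^ card J) p) w
    (\<lambda>i. (LINT x|PiM J (\<lambda>_. lborel). g i x) / (LINT x|PiM J (\<lambda>_. lborel). f i x))"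
  using J p f g AE
proof (induction J arbitrary: f g rule: finite_induct)
  case empty
  have int: "(LINT x|PiM {} (\<lambda>_. lborel). v x) = v (\<lambda>_. undefined)" for v :: "('d \<Rightarrow> real) \<Rightarrow> real"
    by (simp add: PiM_empty lebesgue_integral_count_space_finite)
  \<comment> \<open>The empty product is a unit mass at the everywhere undefined function, so
    integrals are values and the almost-everywhere hypothesis is the claim itself.\<close>
  have "\<forall>i. 0 < f i (\<lambda>_. undefined)" using empty.prems(4) by (simp add: int)
  then have "K \<le> power_mean p w (\<lambda>i. g i (\<lambda>_. undefined) / f i (\<lambda>_. undefined))"
    using empty.prems(7) unfolding PiM_empty by (simp add: AE_count_space restrict_def)
  then show ?case by (simp add: int)
next
  case (insert j J)
  note psf = lborel_power.product_sigma_finite_axioms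
  note ins = insert.hyps(1,2) psf
  note f = insert.prems(2-4) and g = insert.prems(5,6)
  define F where "F i y = (LINT t|PiM J (\<lambda>_. lborel). f i (t(j := y)))" for i y
  define G where "G i y = (LINT t|PiM J (\<lambda>_. lborel). g i (t(j := y)))" for i y
  have upd: "(\<lambda>k\<in>insert j J. (X(j := Y)) k $ i) = (\<lambda>k\<in>J. X k $ i)(j := Y $ i)"
    "(\<lambda>k\<in>insert j J. \<Sum>l\<in>UNIV. w l * (X(j := Y)) k $ l)
      = (\<lambda>k\<in>J. \<Sum>l\<in>UNIV. w l * X k $ l)(j := \<Sum>l\<in>UNIV. w l * Y $ l)"
    for X and Y :: "real ^ 'm" and i
    using insert.hyps(2) by (auto simp: fun_eq_iff)
  have AE': "AE Y in lborel. AE X in PiM J (\<lambda>_. lborel :: (real ^ 'm) measure).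
      (\<forall>i. 0 < f i ((\<lambda>k\<in>J. X k $ i)(j := Y $ i))) \<longrightarrow>
      K \<le> power_mean p w (\<lambda>i. g i ((\<lambda>k\<in>J. \<Sum>l\<in>UNIV. w l * X k $ l)(j := \<Sum>l\<in>UNIV. w l * Y $ l))
        / f i ((\<lambda>k\<in>J. X k $ i)(j := Y $ i)))"
    using AE_PiM_insert(1)[OF ins insert.prems(7)] by (simp only: upd)
  \<comment> \<open>Fubini gives integrable sections only for almost every real value of coordinate
    \<open>j\<close>. Pulling back along the surjective linear maps \<open>Y $ i\<close>, and below
    along the weighted sum, makes this hold for almost every \<open>Y\<close>.\<close>
  have intf: "AE Y in (lborel :: (real ^ 'm) measure). \<forall>i. integrable (PiM J (\<lambda>_. lborel)) (\<lambda>t. f i (t(j := Y $ i)))"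
  proof (rule AE_all_countable[THEN iffD2], rule allI)
    fix i
    have "surj (\<lambda>Y :: real ^ 'm. Y $ i)" by (rule surjI[of _ "\<lambda>s. \<chi> i. s"]) simp
    then show "AE Y in (lborel :: (real ^ 'm) measure). integrable (PiM J (\<lambda>_. lborel)) (\<lambda>t. f i (t(j := Y $ i)))"
      by (intro AE_lborel_linear_surj[of "\<lambda>Y. Y $ i"] integrable_PiM_insert(1)[OF ins f(2)])
        (auto simp: linear_iff)
  qed
  have intg: "AE Y in (lborel :: (real ^ 'm) measure).
    \<forall>i. integrable (PiM J (\<lambda>_. lborel)) (\<lambda>t. g i (t(j := \<Sum>l\<in>UNIV. w l * Y $ l)))"
  proof (rule AE_all_countable[THEN iffD2], rule allI)
    fix i
    have "surj (\<lambda>Y :: real ^ 'm. \<Sum>l\<in>UNIV. w l * Y $ l)"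
      by (rule surjI[of _ "\<lambda>s. \<chi> i. s"]) (use w in \<open>simp add: weight_def flip: sum_distrib_right\<close>)
    moreover have "linear (\<lambda>Y :: real ^ 'm. \<Sum>l\<in>UNIV. w l * Y $ l)"
      by (auto simp: linear_iff algebra_simps sum.distrib sum_distrib_left)
    ultimately show "AE Y in (lborel :: (real ^ 'm) measure).
        integrable (PiM J (\<lambda>_. lborel)) (\<lambda>t. g i (t(j := \<Sum>l\<in>UNIV. w l * Y $ l)))"
      by (intro AE_lborel_linear_surj[of "\<lambda>Y. \<Sum>l\<in>UNIV. w l * Y $ l"] integrable_PiM_insert(1)[OF ins g(2)])
  qed
  \<comment> \<open>For fixed \<open>Y\<close> the induction hypothesis is applied to the sections
    of \<open>f i\<close> at \<open>Y $ i\<close> and of \<open>g i\<close> at the weighted sum of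
    \<open>Y\<close>. Positivity of \<open>F i (Y $ i)\<close> is its assumption on the
    integrals.\<close>
  have "AE Y in (lborel :: (real ^ 'm) measure). (\<forall>i. 0 < F i (Y $ i)) \<longrightarrow>
      K \<le> power_mean ((power_transform 1 ^^ card J) p) w (\<lambda>i. G i (\<Sum>l\<in>UNIV. w l * Y $ l) / F i (Y $ i))"
    using AE' intf intg
  proof eventually_elim
    case (elim Y)
    show ?case
    proof
      assume pos: "\<forall>i. 0 < F i (Y $ i)"
      show "K \<le> power_mean ((power_transform 1 ^^ card J) p) w (\<lambda>i. G i (\<Sum>l\<in>UNIV. w l * Y $ l) / F i (Y $ i))"
        unfolding F_def G_def
      proof (rule insert.IH)
        show "(power_transform 1 ^^ k) p \<le> 1" if "k < card J" for k
          using that insert.hyps by (intro insert.prems(1)) simp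
      qed (use elim pos f(1) g(1) in \<open>simp_all only: F_def\<close>)
    qed
  qed
  \<comment> \<open>The section integrals \<open>F\<close> and \<open>G\<close> now satisfy the
    one-dimensional hypothesis in coordinate \<open>j\<close>, at the cost of one more
    \<open>Q_1\<close>.\<close>
  then have "K \<le> power_mean (power_transform 1 ((power_transform 1 ^^ card J) p)) w
      (\<lambda>i. (LINT y|lborel. G i y) / (LINT y|lborel. F i y))"
  proof (rule one_dim_power_mean[OF w, rotated -1])
    show "(power_transform 1 ^^ card J) p \<le> 1" using insert.hyps by (intro insert.prems(1)) simp
    show "0 \<le> F i y" "0 \<le> G i y" for i y unfolding F_def G_def using f(1) g(1) by simp_all
    show "integrable lborel (F i)" for i
      unfolding F_def by (rule integrable_PiM_insert(2)[OF ins f(2)])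
    show "integrable lborel (G i)" for i
      unfolding G_def by (rule integrable_PiM_insert(2)[OF ins g(2)])
    show "0 < (LINT y|lborel. F i y)" for i
      using f(3)[of i] unfolding F_def integrable_PiM_insert(3)[OF ins f(2)] .
  qed
  then show ?case
    unfolding integrable_PiM_insert(3)[OF ins f(2)] integrable_PiM_insert(3)[OF ins g(2)]
    using insert.hyps by (simp add: F_def[abs_def] G_def[abs_def])
qed

section \<open>Borel representatives and the passage to vectors\<close>

lemma ex_borel_nonneg_AE_eq:
  fixes f :: "'a::euclidean_space \<Rightarrow> real"
  assumes f: "integrable lebesgue f" "\<And>x. 0 \<le> f x"
  obtains f' where "f' \<in> borel_measurable borel" "\<And>x. 0 \<le> f' x" "AE x in lborel. f x = f' x"
    "integrable lborel f'" "(LINT x|lborel. f' x) = L1_norm f"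
proof -
  obtain h where h: "h \<in> borel_measurable lborel" "AE x in lborel. f x = h x"
    using completion_ex_borel_measurable_real[OF borel_measurable_integrable[OF f(1)]] by auto
  \<comment> \<open>The Borel representative may be negative on a null set; the maximum makes it
    nonnegative everywhere.\<close>
  define f' where "f' x = max 0 (h x)" for x
  have m: "f' \<in> borel_measurable lborel" using h(1) unfolding f'_def by measurable
  have eq: "AE x in lborel. f x = f' x"
    using h(2)
  proof eventually_elim
    case (elim x)
    then show ?case using f(2)[of x] by (simp add: f'_def)
  qed
  have m': "f' \<in> borel_measurable lebesgue" using m by (rule measurable_completion)
  have eq': "AE x in lebesgue. f x = f' x" using eq by (simp add: AE_completion_iff)
  have "integrable lebesgue f'"
    using f(1) eq' m' by (subst integrable_cong_AE[of _ _ f]) (auto elim: eventually_mono)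
  then have "integrable lborel f'" using integrable_completion[OF m] by simp
  moreover have "(LINT x|lborel. f' x) = L1_norm f"
  proof -
    have "L1_norm f = (LINT x|lebesgue. f' x)"
      unfolding L1_norm_def using eq' f m' by (intro integral_cong_AE) auto
    then show ?thesis using integral_completion[OF m] by simp
  qed
  ultimately show ?thesis using that[of f'] m eq by (auto simp: f'_def)
qed

lemma linear_component: "linear (\<lambda>x :: 'a::real_vector ^ 'm::finite. x $ i)"
  by (simp add: linear_iff)

lemma surj_component: "surj (\<lambda>x :: 'a::real_vector ^ 'm::finite. x $ i)"
  by (rule surjI[of _ "\<lambda>s. \<chi> i. s"]) simp

lemma linear_weighted_sum: "linear (weighted_sum w)"
  by (simp add: linear_iff weighted_sum_def scaleR_add_right sum.distrib scaleR_sum_right mult.commute)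

lemma surj_weighted_sum:
  assumes "weight w"
  shows "surj (weighted_sum w)"
  by (rule surjI[of _ "\<lambda>s. \<chi> i. s"])
    (use assms in \<open>simp add: weighted_sum_def weight_def flip: scaleR_sum_left\<close>)

lemma power_mean_ratio_AE_bound:
  fixes w :: "'m::finite \<Rightarrow> real" and p :: ereal
    and f g :: "'m \<Rightarrow> real ^ 'd::finite \<Rightarrow> real"
  assumes w: "weight w" and p: "p \<le> ereal (1 / real CARD('d))"
    and f: "\<And>i x. 0 \<le> f i x" "\<And>i. f i \<in> borel_measurable borel" "\<And>i. integrable lborel (f i)"
      "\<And>i. 0 < (LINT x|lborel. f i x)"
    and g: "\<And>i x. 0 \<le> g i x" "\<And>i. g i \<in> borel_measurable borel" "\<And>i. integrable lborel (g i)"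
    and AE: "AE x in (lborel :: (real ^ 'd ^ 'm) measure). (\<forall>i. 0 < f i (x $ i)) \<longrightarrow>
      K \<le> power_mean p w (\<lambda>i. g i (weighted_sum w x) / f i (x $ i))"
  shows "K \<le> power_mean (power_transform CARD('d) p) w
    (\<lambda>i. (LINT x|lborel. g i x) / (LINT x|lborel. f i x))"
proof -
  have n: "0 < CARD('d)" by simp
  then obtain m where m: "CARD('d) = Suc m" by (cases "CARD('d)") auto
  have p_le: "p \<le> ereal r" if "1 / real CARD('d) \<le> r" for r
    using p that by (simp add: order_trans[of p "ereal (1 / real CARD('d))"])
  \<comment> \<open>For \<open>k > 0\<close> the iterate is \<open>Q_k(p)\<close>, and
    \<open>p \<le> 1 / (k + 1)\<close> because \<open>k + 1\<close> is at most the dimension. For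
    \<open>k = 0\<close> it is \<open>p\<close> itself.\<close>
  have pk: "(power_transform 1 ^^ k) p \<le> 1" if k: "k < CARD('d)" for k
  proof (cases k)
    case 0
    then show ?thesis using p_le[of 1] by (simp add: m one_ereal_def)
  next
    case (Suc l)
    have "(power_transform 1 ^^ k) p = power_transform k p"
      unfolding Suc using k Suc by (intro power_transform_funpow p_le divide_left_mono) auto
    also have "\<dots> \<le> 1"
      using k Suc by (intro power_transform_le_one p_le divide_left_mono) auto
    finally show ?thesis .
  qed
  have int: "integrable (PiM UNIV (\<lambda>_. lborel)) (\<lambda>t. v (vec_lambda t))"
      "(LINT t|PiM UNIV (\<lambda>_. lborel). v (vec_lambda t)) = (LINT x|lborel. v x)"
    if "v \<in> borel_measurable borel" "integrable lborel v" for v :: "real ^ 'd \<Rightarrow> real"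
    using that integrable_distr_eq[OF measurable_vec_lambda, of v] integral_distr[OF measurable_vec_lambda, of v]
    by (simp_all flip: lborel_vec_eq_distr_PiM)
  \<comment> \<open>The induction runs over coordinates, so all points' entries in one coordinate
    must be grouped together. Transposition is a linear surjection and hence respects
    almost-everywhere statements.\<close>
  define T :: "real ^ 'm ^ 'd \<Rightarrow> real ^ 'd ^ 'm" where "T x = (\<chi> i j. x $ j $ i)" for x
  have "linear T" by (auto simp: linear_iff T_def vec_eq_iff)
  moreover have "surj T" by (rule surjI[of _ "\<lambda>x. \<chi> i j. x $ j $ i"]) (simp add: T_def vec_eq_iff)
  ultimately have "AE x in (lborel :: (real ^ 'm ^ 'd) measure). (\<forall>i. 0 < f i (T x $ i)) \<longrightarrow>
      K \<le> power_mean p w (\<lambda>i. g i (weighted_sum w (T x)) / f i (T x $ i))"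
    by (rule AE_lborel_linear_surj[OF _ _ AE])
  from AE_PiM_of_AE_lborel_vec[OF this]
  have AE': "AE X in PiM UNIV (\<lambda>_. lborel :: (real ^ 'm) measure).
      (\<forall>i. 0 < f i (vec_lambda (\<lambda>j\<in>UNIV. X j $ i))) \<longrightarrow>
      K \<le> power_mean p w (\<lambda>i. g i (vec_lambda (\<lambda>j\<in>UNIV. \<Sum>k\<in>UNIV. w k * X j $ k))
        / f i (vec_lambda (\<lambda>j\<in>UNIV. X j $ i)))"
  proof eventually_elim
    case (elim X)
    have "T (vec_lambda X) $ i = vec_lambda (\<lambda>j\<in>UNIV. X j $ i)" for i
      by (simp add: T_def vec_eq_iff)
    moreover have "weighted_sum w (T (vec_lambda X)) = vec_lambda (\<lambda>j\<in>UNIV. \<Sum>k\<in>UNIV. w k * X j $ k)"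
      by (simp add: T_def vec_eq_iff weighted_sum_def)
    ultimately show ?case using elim by simp
  qed
  have "K \<le> power_mean ((power_transform 1 ^^ card (UNIV :: 'd set)) p) w
    (\<lambda>i. (LINT t|PiM (UNIV :: 'd set) (\<lambda>_. lborel). g i (vec_lambda t))
       / (LINT t|PiM (UNIV :: 'd set) (\<lambda>_. lborel). f i (vec_lambda t)))"
    by (rule power_mean_integral_PiM[OF w _ pk _ _ _ _ _ AE']) (use f g in \<open>auto simp: int\<close>)
  moreover have "(power_transform 1 ^^ CARD('d)) p = power_transform CARD('d) p"
    unfolding m using p by (intro power_transform_funpow) (simp add: m)
  ultimately show ?thesis using f g by (simp add: int)
qed

theorem theorem1p3:
  fixes w :: "'m::finite \<Rightarrow> real"
    and p :: ereal
    and f g :: "'m \<Rightarrow> real ^ 'd::finite \<Rightarrow> real"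
    and S :: "(real ^ 'd ^ 'm) set"
    and L :: "real ^ 'd ^ 'm \<Rightarrow> real"
    and K :: ereal
  assumes "weight w"
    and "p \<le> ereal (1 / real CARD('d))"
    and "\<And>i x. 0 \<le> f i x"
    and "\<And>i x. 0 \<le> g i x"
    and "\<And>i. integrable lebesgue (f i)"
    and "\<And>i. integrable lebesgue (g i)"
    and "\<And>i. 0 < L1_norm (f i)"
  defines "S \<equiv> {x. \<forall>i. x $ i \<in> pos_set (f i)}"
    and "L \<equiv> \<lambda>x. power_mean p w (\<lambda>i. g i (weighted_sum w x) / f i (x $ i))"
    and "K \<equiv> ess_inf (lebesgue_on S) (\<lambda>x. ereal (L x))"
  shows "K \<le> ereal (power_mean (power_transform CARD('d) p) w
                       (\<lambda>i. L1_norm (g i) / L1_norm (f i)))"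
proof -
  define R where "R = power_mean (power_transform CARD('d) p) w (\<lambda>i. L1_norm (g i) / L1_norm (f i))"
  have "\<exists>h. h \<in> borel_measurable borel \<and> (\<forall>x. 0 \<le> h x) \<and> (AE x in lborel. f i x = h x) \<and>
      integrable lborel h \<and> (LINT x|lborel. h x) = L1_norm (f i)" for i
    by (rule ex_borel_nonneg_AE_eq[OF assms(5,3)]) blast
  from choice[OF allI[OF this]] obtain f' where *: "\<forall>i. f' i \<in> borel_measurable borel \<and> (\<forall>x. 0 \<le> f' i x) \<and>
      (AE x in lborel. f i x = f' i x) \<and> integrable lborel (f' i) \<and> (LINT x|lborel. f' i x) = L1_norm (f i)"
    by (rule exE)
  have f': "\<And>i. f' i \<in> borel_measurable borel" "\<And>i x. 0 \<le> f' i x"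
    "\<And>i. AE x in lborel. f i x = f' i x" "\<And>i. integrable lborel (f' i)"
    "\<And>i. (LINT x|lborel. f' i x) = L1_norm (f i)" using * by blast+
  have "\<exists>h. h \<in> borel_measurable borel \<and> (\<forall>x. 0 \<le> h x) \<and> (AE x in lborel. g i x = h x) \<and>
      integrable lborel h \<and> (LINT x|lborel. h x) = L1_norm (g i)" for i
    by (rule ex_borel_nonneg_AE_eq[OF assms(6,4)]) blast
  from choice[OF allI[OF this]] obtain g' where *: "\<forall>i. g' i \<in> borel_measurable borel \<and> (\<forall>x. 0 \<le> g' i x) \<and>
      (AE x in lborel. g i x = g' i x) \<and> integrable lborel (g' i) \<and> (LINT x|lborel. g' i x) = L1_norm (g i)"
    by (rule exE)
  have g': "\<And>i. g' i \<in> borel_measurable borel" "\<And>i x. 0 \<le> g' i x"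
    "\<And>i. AE x in lborel. g i x = g' i x" "\<And>i. integrable lborel (g' i)"
    "\<And>i. (LINT x|lborel. g' i x) = L1_norm (g i)" using * by blast+
  \<comment> \<open>Exceptional null sets in the space of single points have null preimages under
    the components and under the weighted sum, as these are linear surjections. The representatives
    therefore do not affect the essential bound.\<close>
  have AEf: "AE x in (lborel :: (real ^ 'd ^ 'm) measure). \<forall>i. f i (x $ i) = f' i (x $ i)"
    unfolding AE_all_countable
    by (intro allI AE_lborel_linear_surj[OF linear_component surj_component f'(3)])
  have AEg: "AE x in (lborel :: (real ^ 'd ^ 'm) measure). \<forall>i. g i (weighted_sum w x) = g' i (weighted_sum w x)"
    unfolding AE_all_countable
    by (intro allI AE_lborel_linear_surj[OF linear_weighted_sum surj_weighted_sum[OF assms(1)] g'(3)])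
  define S' :: "(real ^ 'd ^ 'm) set" where "S' = {x. \<forall>i. 0 < f' i (x $ i)}"
  have S'[measurable]: "S' \<in> sets lborel"
  proof -
    have [measurable]: "(\<lambda>x :: real ^ 'd ^ 'm. x $ i) \<in> borel_measurable borel" for i
      by (intro borel_measurable_continuous_onI continuous_intros)
    note f'(1)[measurable]
    have "S' = (\<Inter>i. {x \<in> space borel. 0 < f' i (x $ i)})" by (auto simp: S'_def)
    also have "\<dots> \<in> sets borel" by measurable
    finally show ?thesis by simp
  qed
  \<comment> \<open>\<open>S\<close> agrees up to a null set with a Borel set, so completeness makes
    it Lebesgue measurable. A bound almost everywhere on \<open>S\<close> can then be read as an
    implication on the whole space.\<close>
  have "AE x in lborel. x \<in> S' \<longleftrightarrow> x \<in> S"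
    using AEf by eventually_elim (simp add: S_def S'_def pos_set_def)
  then have "AE x in lebesgue. x \<in> S' \<longleftrightarrow> x \<in> S" by (simp add: AE_completion_iff)
  then have S: "S \<in> sets lebesgue"
    by (rule completion.in_sets_AE) (use S' in auto)
  have real_le: "k \<le> R" if k: "AE x in lebesgue_on S. ereal k \<le> ereal (L x)" for k
  proof -
    have "AE x in lebesgue. x \<in> S \<longrightarrow> k \<le> L x"
      using k S by (simp add: AE_restrict_space_iff)
    then have "AE x in lborel. x \<in> S \<longrightarrow> k \<le> L x" by (simp add: AE_completion_iff)
    then have "AE x in lborel. (\<forall>i. 0 < f' i (x $ i)) \<longrightarrow>
       k \<le> power_mean p w (\<lambda>i. g' i (weighted_sum w x) / f' i (x $ i))"
      using AEf AEg by eventually_elim (simp add: S_def L_def pos_set_def)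
    then have "k \<le> power_mean (power_transform CARD('d) p) w
        (\<lambda>i. (LINT x|lborel. g' i x) / (LINT x|lborel. f' i x))"
      using f' g' assms(7) by (intro power_mean_ratio_AE_bound[OF assms(1,2)]) auto
    then show ?thesis by (simp add: f' g' R_def)
  qed
  have "c \<le> ereal R" if c: "AE x in lebesgue_on S. c \<le> ereal (L x)" for c
  proof (cases c)
    case (real k)
    then show ?thesis using real_le c by simp
  next
    case PInf
    \<comment> \<open>An infinite essential lower bound would make the real number
      \<open>R + 1\<close> one as well, contradicting \<open>real_le\<close>.\<close>
    have "AE x in lebesgue_on S. ereal (R + 1) \<le> ereal (L x)"
      using c by (rule eventually_mono) (simp add: PInf)
    from real_le[OF this] show ?thesis by simp
  qed simp
  then show ?thesis unfolding K_def ess_inf_def R_def[symmetric] by (intro Sup_least) auto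
qed

end
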